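(* (i) If $p>2$ is a prime and $G$ is a finite powerful $p$-group, then $\exp\Gamma_{\mathrm u}(G)=\exp G$. (ii) If $G$ is a finite abelian $2$-group of exponent $n$, then $\exp\Gamma_{\mathrm u}(G)=2^{\sigma}\cdot\exp G$, where $\sigma=1$ if $G$ has a subgroup isomorphic to $C_n\times C_n$, and $\sigma=0$ otherwise.
   Context: All groups are finite; $\exp$ is the exponent, $o(g)$ the order of $g$, $C_n$ the cyclic group of order $n$. For $p>2$, a $p$-group $G$ is powerful if its derived subgroup satisfies $G'\le\mho(G)$, where $\mho(G)=\langle g^p\mid g\in G\rangle$. $Z^2(G)$ is the group, under pointwise multiplication, of normalized 2-cocycles $\alpha:G\times G\to\mathbb{C}^\times$, i.e. $\alpha(x,y)\alpha(xy,z)=\alpha(x,yz)\alpha(y,z)$ and $\alpha(1,1)=1$. For a finite abelian group $A$, $\check A=\mathrm{Hom}(A,\mathbb{C}^\times)$. For a finite subgroup $H\le Z^2(G)$, the central extension $\check H\propto G$ of $G$ by $\check H$ is defined on the set $G\times\check H$ with multiplication $(g,\chi)(h,\psi)=(gh,\omega(g,h)\chi\psi)$, where $\omega(g,h)\in\check H$ is $\omega(g,h)(\alpha)=\alpha(g,h)$ for $\alpha\in H$. A cocycle $\alpha\in Z^2(G)$ is unitary if $\prod_{j=0}^{o(g)-1}\alpha(g,g^j)=1$ for every $g\in G$. The unitary cocycles form a finite subgroup $Z_{\mathrm u}(G)\le Z^2(G)$, and the unitary cover of $G$ is $\Gamma_{\mathrm u}(G)=\check{Z_{\mathrm u}(G)}\propto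 G$.
   Formalization: In (ii) G is assumed nontrivial: for the trivial group n = 1, so C_1×C_1 is a subgroup and σ = 1, yet Γ_u(G) is trivial of exponent 1 rather than 2. *)

theory Defs
  imports Complex_Main "HOL-Algebra.Algebra"
begin

definition group_exponent :: "('a, 'b) monoid_scheme \<Rightarrow> nat" where
  "group_exponent G = (LEAST n. 0 < n \<and> (\<forall>g \<in> carrier G. g [^]\<^bsub>G\<^esub> n = \<one>\<^bsub>G\<^esub>))"

definition finite_p_group :: "nat \<Rightarrow> ('a, 'b) monoid_scheme \<Rightarrow> bool" where
  "finite_p_group p G \<longleftrightarrow> group G \<and> finite (carrier G) \<and> (\<exists>k. order G = p ^ k)"

definition agemo :: "nat \<Rightarrow> ('a, 'b) monoid_scheme \<Rightarrow> 'a set" where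
  "agemo p G = generate G {g [^]\<^bsub>G\<^esub> p | g. g \<in> carrier G}"

text \<open>This is the notion of powerfulness for odd \<open>p\<close> only; for \<open>p = 2\<close> the usual definition
  requires fourth powers instead.\<close>

definition powerful :: "nat \<Rightarrow> ('a, 'b) monoid_scheme \<Rightarrow> bool" where
  "powerful p G \<longleftrightarrow> derived G (carrier G) \<subseteq> agemo p G"

definition complex_units :: "complex monoid" where
  "complex_units = \<lparr>carrier = UNIV - {0}, monoid.mult = (*), one = 1\<rparr>"

text \<open>Cocycles and characters are functions with a prescribed domain. They are represented by
  functions that are \<^const>\<open>undefined\<close> outside that domain, so that equality of functions on the
  domain is equality in HOL.\<close>

definition cocycle_group :: "('a, 'b) monoid_scheme \<Rightarrow> ('a \<times> 'a \<Rightarrow> complex) monoid" where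
  "cocycle_group G =
    \<lparr>carrier = {\<alpha> \<in> carrier G \<times> carrier G \<rightarrow>\<^sub>E carrier complex_units.
        (\<forall>x \<in> carrier G. \<forall>y \<in> carrier G. \<forall>z \<in> carrier G.
          \<alpha> (x, y) * \<alpha> (x \<otimes>\<^bsub>G\<^esub> y, z) = \<alpha> (x, y \<otimes>\<^bsub>G\<^esub> z) * \<alpha> (y, z)) \<and>
        \<alpha> (\<one>\<^bsub>G\<^esub>, \<one>\<^bsub>G\<^esub>) = 1},
     monoid.mult = (\<lambda>\<alpha> \<beta>. \<lambda>p \<in> carrier G \<times> carrier G. \<alpha> p * \<beta> p),
     one = (\<lambda>p \<in> carrier G \<times> carrier G. 1)\<rparr>"

definition dual_group :: "('a, 'b) monoid_scheme \<Rightarrow> ('a \<Rightarrow> complex) monoid" where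
  "dual_group A =
    \<lparr>carrier = hom A complex_units \<inter> extensional (carrier A),
     monoid.mult = (\<lambda>\<chi> \<psi>. \<lambda>a \<in> carrier A. \<chi> a * \<psi> a),
     one = (\<lambda>a \<in> carrier A. 1)\<rparr>"

definition cocycle_extension ::
    "('a, 'b) monoid_scheme \<Rightarrow> ('a \<times> 'a \<Rightarrow> complex) set
      \<Rightarrow> ('a \<times> (('a \<times> 'a \<Rightarrow> complex) \<Rightarrow> complex)) monoid" where
  "cocycle_extension G H =
    (let D = dual_group ((cocycle_group G)\<lparr>carrier := H\<rparr>);
         \<omega> = (\<lambda>g h. \<lambda>\<alpha> \<in> H. \<alpha> (g, h))
     in \<lparr>carrier = carrier G \<times> carrier D,
         monoid.mult = (\<lambda>(g, \<chi>) (h, \<psi>). (g \<otimes>\<^bsub>G\<^esub> h, \<omega> g h \<otimes>\<^bsub>D\<^esub> \<chi> \<otimes>\<^bsub>D\<^esub> \<psi>)),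
         one = (\<one>\<^bsub>G\<^esub>, \<one>\<^bsub>D\<^esub>)\<rparr>)"

definition unitary_cocycles :: "('a, 'b) monoid_scheme \<Rightarrow> ('a \<times> 'a \<Rightarrow> complex) set" where
  "unitary_cocycles G =
    {\<alpha> \<in> carrier (cocycle_group G).
      \<forall>g \<in> carrier G. (\<Prod>j < group.ord G g. \<alpha> (g, g [^]\<^bsub>G\<^esub> j)) = 1}"

definition unitary_cover ::
    "('a, 'b) monoid_scheme \<Rightarrow> ('a \<times> (('a \<times> 'a \<Rightarrow> complex) \<Rightarrow> complex)) monoid" where
  "unitary_cover G = cocycle_extension G (unitary_cocycles G)"

end

theory Submission
  imports Defs
begin

text \<open>
  For a unitary cocycle \<open>\<alpha>\<close> let \<open>E\<close> be the central extension of \<open>G\<close> by \<open>\<complex>\<^sup>\<times>\<close> with factor set \<open>\<alpha>\<close>.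
  The map \<open>(g, \<chi>) \<mapsto> (g, \<chi> \<alpha>)\<close> sends the unitary cover homomorphically to \<open>E\<close>, and the section
  \<open>g \<mapsto> (g, 1)\<close> preserves orders. Hence the unitary cover has exponent dividing a multiple \<open>n\<close> of
  \<open>exp G\<close> iff \<open>\<alpha>(g, h) ^ n = 1\<close> always, and \<open>\<alpha>(g, h) ^ n\<close> is the \<open>n\<close>-th power of \<open>(g, 1) (h, 1)\<close>.

  If \<open>G\<close> is powerful of exponent \<open>p ^ e\<close>, the \<open>i\<close>-th term of its lower exponent-\<open>p\<close> central series
  consists of \<open>p ^ i\<close>-th powers modulo the next term, so the \<open>e\<close>-th term is trivial. Pulled back to
  \<open>E\<close>, the series descends to the centre in \<open>e\<close> steps, and climbing it shows that the
  \<open>p ^ e\<close>-th power map is a homomorphism on \<open>E\<close>; it kills all \<open>(g, 1)\<close>.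

  If \<open>G\<close> is an abelian 2-group of exponent \<open>n\<close>, then \<open>\<alpha>(g, h) ^ n = c ^ (n / 2 * (n - 1))\<close> for the
  commutator \<open>c = \<alpha>(h, g) / \<alpha>(g, h)\<close>. This can only fail to be 1 if \<open>g ^ (n / 2)\<close> and \<open>h ^ (n / 2)\<close>
  are distinct involutions, and then \<open>g\<close> and \<open>h\<close> generate \<open>C\<^sub>n \<times> C\<^sub>n\<close>. Conversely, extending the coordinate
  characters of such a subgroup to \<open>G\<close> gives a bimultiplicative cocycle with \<open>c\<close> of order \<open>n\<close>,
  which a coboundary makes unitary.
\<close>

section \<open>Commutators and powers in class two\<close>

text \<open>The convention is that of the generators of \<open>derived\<close>, so that the
  hypothesis of powerfulness applies to these commutators after unfolding.\<close>

definition commutator :: "('a, 'b) monoid_scheme \<Rightarrow> 'a \<Rightarrow> 'a \<Rightarrow> 'a" where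
  "commutator G x y = x \<otimes>\<^bsub>G\<^esub> y \<otimes>\<^bsub>G\<^esub> inv\<^bsub>G\<^esub> x \<otimes>\<^bsub>G\<^esub> inv\<^bsub>G\<^esub> y"

context group
begin

lemma commutator_closed [simp, intro]:
  "x \<in> carrier G \<Longrightarrow> y \<in> carrier G \<Longrightarrow> commutator G x y \<in> carrier G"
  by (simp add: commutator_def)

lemma mult_commutator:
  assumes "x \<in> carrier G" "y \<in> carrier G"
  shows "x \<otimes> y = commutator G x y \<otimes> y \<otimes> x"
  using assms by (simp add: commutator_def m_assoc inv_solve_right)

lemma inv_commutator:
  assumes "x \<in> carrier G" "y \<in> carrier G"
  shows "inv (commutator G x y) = commutator G y x"
  using assms by (simp add: commutator_def inv_mult_group m_assoc)

lemma subgroup_nat_pow_closed: "subgroup H G \<Longrightarrow> h \<in> H \<Longrightarrow> h [^] (n::nat) \<in> H"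
  by (induction n) (auto intro: subgroup.one_closed subgroup.m_closed)

lemma pow_commute:
  assumes "x \<in> carrier G" "y \<in> carrier G" "x \<otimes> y = y \<otimes> x"
  shows "x [^] (n::nat) \<otimes> y = y \<otimes> x [^] n"
proof (induction n)
  case (Suc n)
  then show ?case using assms by (metis m_assoc nat_pow_Suc nat_pow_closed)
qed (use assms in simp)

lemma pow_mult_commute_central:
  assumes [simp]: "x \<in> carrier G" "y \<in> carrier G" "c \<in> carrier G"
    and yx: "y \<otimes> x = c \<otimes> x \<otimes> y" and cx: "c \<otimes> x = x \<otimes> c" and cy: "c \<otimes> y = y \<otimes> c"
  shows "y [^] (n::nat) \<otimes> x = c [^] n \<otimes> x \<otimes> y [^] n"
proof (induction n)
  case (Suc n)
  have "y [^] Suc n \<otimes> x = y [^] n \<otimes> (y \<otimes> x)"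
    by (simp add: m_assoc)
  also have "\<dots> = (y [^] n \<otimes> c) \<otimes> (x \<otimes> y)"
    by (simp add: yx m_assoc)
  also have "y [^] n \<otimes> c = c \<otimes> y [^] n"
    by (rule pow_commute) (use cy in simp_all)
  also have "(c \<otimes> y [^] n) \<otimes> (x \<otimes> y) = c \<otimes> (y [^] n \<otimes> x) \<otimes> y"
    by (simp add: m_assoc)
  also have "\<dots> = (c \<otimes> c [^] n) \<otimes> x \<otimes> (y [^] n \<otimes> y)"
    by (simp add: Suc m_assoc)
  also have "c \<otimes> c [^] n = c [^] Suc n"
    by (simp only: nat_pow_Suc2 assms)
  finally show ?case by simp
qed simp

text \<open>When all factors \<open>x\<close> are moved to the left, the \<open>k\<close>-th one
  passes \<open>k - 1\<close> factors \<open>y\<close> and leaves as many copies of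
  \<open>c\<close>. These add up to \<open>n * (n - 1) div 2\<close>.\<close>

lemma pow_mult_class_two:
  assumes [simp]: "x \<in> carrier G" "y \<in> carrier G" "c \<in> carrier G"
    and yx: "y \<otimes> x = c \<otimes> x \<otimes> y" and cx: "c \<otimes> x = x \<otimes> c" and cy: "c \<otimes> y = y \<otimes> c"
  shows "(x \<otimes> y) [^] (n::nat) = c [^] (n * (n - 1) div 2) \<otimes> x [^] n \<otimes> y [^] n"
proof (induction n)
  case (Suc n)
  have exp: "n * (n - 1) div 2 + n = Suc n * (Suc n - 1) div 2"
    by (cases n) (auto simp: algebra_simps)
  have "(x \<otimes> y) [^] Suc n = c [^] (n * (n - 1) div 2) \<otimes> x [^] n \<otimes> (y [^] n \<otimes> x) \<otimes> y"
    by (simp add: Suc m_assoc)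
  also have "y [^] n \<otimes> x = c [^] n \<otimes> x \<otimes> y [^] n"
    by (rule pow_mult_commute_central) (use assms in simp_all)
  also have "c [^] (n * (n - 1) div 2) \<otimes> x [^] n \<otimes> (c [^] n \<otimes> x \<otimes> y [^] n) \<otimes> y
      = c [^] (n * (n - 1) div 2) \<otimes> (x [^] n \<otimes> c [^] n) \<otimes> x \<otimes> (y [^] n \<otimes> y)"
    by (simp add: m_assoc)
  also have "x [^] n \<otimes> c [^] n = c [^] n \<otimes> x [^] n"
    by (metis assms(1,3) cx nat_pow_closed pow_commute)
  also have "c [^] (n * (n - 1) div 2) \<otimes> (c [^] n \<otimes> x [^] n) \<otimes> x \<otimes> (y [^] n \<otimes> y)
      = (c [^] (n * (n - 1) div 2) \<otimes> c [^] n) \<otimes> x [^] Suc n \<otimes> y [^] Suc n"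
    by (simp add: m_assoc)
  also have "c [^] (n * (n - 1) div 2) \<otimes> c [^] n = c [^] (Suc n * (Suc n - 1) div 2)"
    by (simp only: nat_pow_mult exp assms)
  finally show ?case .
qed simp

lemma odd_pow_mult_class_two:
  assumes [simp]: "x \<in> carrier G" "y \<in> carrier G" "c \<in> carrier G"
    and yx: "y \<otimes> x = c \<otimes> x \<otimes> y" and cx: "c \<otimes> x = x \<otimes> c" and cy: "c \<otimes> y = y \<otimes> c"
    and "odd p" and cp: "c [^] p = \<one>"
  shows "(x \<otimes> y) [^] (p::nat) = x [^] p \<otimes> y [^] p"
proof -
  \<comment> \<open>Oddness enters here: it makes the exponent of \<open>c\<close> a multiple of
    \<open>p\<close>.\<close>
  have "p * (p - 1) div 2 = p * ((p - 1) div 2)"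
    using \<open>odd p\<close> by (simp add: div_mult_swap)
  then have "c [^] (p * (p - 1) div 2) = \<one>"
    by (simp add: nat_pow_pow [symmetric] cp)
  then show ?thesis
    using pow_mult_class_two [OF assms(1-6), of p] by simp
qed

end

section \<open>Calculations modulo a normal subgroup\<close>

context normal
begin

lemma rcos_eq_iff:
  assumes "x \<in> carrier G" "y \<in> carrier G"
  shows "H #> x = H #> y \<longleftrightarrow> x \<otimes> inv y \<in> H"
proof
  assume "H #> x = H #> y"
  then have "x \<in> H #> y"
    using rcos_self [of x H] assms subgroup_axioms by simp
  then show "x \<otimes> inv y \<in> H"
    using assms rcos_module [of y x] is_group by simp
next
  assume "x \<otimes> inv y \<in> H"
  then have "x \<in> H #> y"
    using assms rcos_module [of y x] is_group by simp
  then show "H #> x = H #> y"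
    using repr_independence [of x H y] assms subgroup_axioms by simp
qed

lemma rcos_one_iff: "x \<in> carrier G \<Longrightarrow> H #> x = H \<longleftrightarrow> x \<in> H"
  using rcos_eq_iff [of x \<one>] by (simp add: subset)

lemma group_hom_rcos: "group_hom G (G Mod H) ((#>) H)"
  by (simp add: group_hom.intro group_hom_axioms_def factorgroup_is_group r_coset_hom_Mod is_group)

lemma rcos_mult: "x \<in> carrier G \<Longrightarrow> y \<in> carrier G \<Longrightarrow> H #> (x \<otimes> y) = (H #> x) \<otimes>\<^bsub>G Mod H\<^esub> (H #> y)"
  by (simp add: rcos_sum)

lemma rcos_pow: "x \<in> carrier G \<Longrightarrow> H #> (x [^] (n::nat)) = (H #> x) [^]\<^bsub>G Mod H\<^esub> n"
  using group_hom.hom_nat_pow [OF group_hom_rcos] .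

lemma rcos_commute:
  assumes "x \<in> carrier G" "y \<in> carrier G" "commutator G x y \<in> H"
  shows "(H #> x) \<otimes>\<^bsub>G Mod H\<^esub> (H #> y) = (H #> y) \<otimes>\<^bsub>G Mod H\<^esub> (H #> x)"
proof -
  have "H #> (x \<otimes> y) = H #> (y \<otimes> x)"
    using assms by (subst rcos_eq_iff) (auto simp: commutator_def inv_mult_group m_assoc)
  then show ?thesis using assms by (simp add: rcos_mult)
qed

text \<open>This is the class two formula in the quotient by \<open>H\<close>: there the commutator
  of \<open>y\<close> and \<open>x\<close> commutes with both elements and has trivial
  \<open>p\<close>-th power.\<close>

lemma odd_pow_mult_rcos:
  assumes x: "x \<in> carrier G" and y: "y \<in> carrier G" and "odd p"
    and cx: "commutator G (commutator G y x) x \<in> H"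
    and cy: "commutator G (commutator G y x) y \<in> H"
    and cp: "commutator G y x [^] p \<in> H"
  shows "H #> (x \<otimes> y) [^] (p::nat) = H #> (x [^] p \<otimes> y [^] p)"
proof -
  interpret Q: group "G Mod H" by (rule factorgroup_is_group)
  interpret h: group_hom G "G Mod H" "(#>) H" by (rule group_hom_rcos)
  let ?c = "H #> commutator G y x"
  have "((H #> x) \<otimes>\<^bsub>G Mod H\<^esub> (H #> y)) [^]\<^bsub>G Mod H\<^esub> p
      = (H #> x) [^]\<^bsub>G Mod H\<^esub> p \<otimes>\<^bsub>G Mod H\<^esub> (H #> y) [^]\<^bsub>G Mod H\<^esub> p"
  proof (rule Q.odd_pow_mult_class_two [where c = ?c])
    show "(H #> y) \<otimes>\<^bsub>G Mod H\<^esub> (H #> x) = ?c \<otimes>\<^bsub>G Mod H\<^esub> (H #> x) \<otimes>\<^bsub>G Mod H\<^esub> (H #> y)"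
      using x y by (simp flip: rcos_mult mult_commutator del: mult_FactGroup)
    show "?c [^]\<^bsub>G Mod H\<^esub> p = \<one>\<^bsub>G Mod H\<^esub>"
      using x y cp by (simp add: rcos_one_iff flip: rcos_pow)
  qed (use x y cx cy rcos_commute \<open>odd p\<close> in auto)
  then show ?thesis
    using x y by (simp add: rcos_mult rcos_pow del: mult_FactGroup)
qed

end

section \<open>Central series that absorb \<open>p\<close>-th powers\<close>

context normal
begin

lemma rcos_absorb:
  assumes "h \<in> H" "x \<in> carrier G"
  shows "H #> (h \<otimes> x) = H #> x"
  using assms by (simp add: rcos_eq_iff m_assoc)

text \<open>Modulo \<open>H\<close> the commutator \<open>c\<close> commutes with \<open>x\<close>
  and \<open>y\<close>, so moving \<open>y ^ p\<close> past \<open>x\<close> costs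
  \<open>c ^ p\<close>. But \<open>y ^ p\<close> commutes with \<open>x\<close> modulo
  \<open>H\<close>, so \<open>c ^ p\<close> vanishes.\<close>

lemma commutator_pow_rcos:
  assumes x: "x \<in> carrier G" and y: "y \<in> carrier G"
    and cx: "commutator G (commutator G y x) x \<in> H"
    and cy: "commutator G (commutator G y x) y \<in> H"
    and yp: "commutator G (y [^] (p::nat)) x \<in> H"
  shows "commutator G y x [^] p \<in> H"
proof -
  interpret Q: group "G Mod H" by (rule factorgroup_is_group)
  interpret h: group_hom G "G Mod H" "(#>) H" by (rule group_hom_rcos)
  define a b c where "a = H #> x" and "b = H #> y" and "c = H #> commutator G y x"
  have [simp]: "a \<in> carrier (G Mod H)" "b \<in> carrier (G Mod H)" "c \<in> carrier (G Mod H)"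
    using x y h.hom_closed by (auto simp: a_def b_def c_def)
  have "b [^]\<^bsub>G Mod H\<^esub> p \<otimes>\<^bsub>G Mod H\<^esub> a
      = c [^]\<^bsub>G Mod H\<^esub> p \<otimes>\<^bsub>G Mod H\<^esub> a \<otimes>\<^bsub>G Mod H\<^esub> b [^]\<^bsub>G Mod H\<^esub> p"
  proof (rule Q.pow_mult_commute_central)
    show "b \<otimes>\<^bsub>G Mod H\<^esub> a = c \<otimes>\<^bsub>G Mod H\<^esub> a \<otimes>\<^bsub>G Mod H\<^esub> b"
      unfolding a_def b_def c_def
      using x y by (simp flip: rcos_mult mult_commutator del: mult_FactGroup)
    show "c \<otimes>\<^bsub>G Mod H\<^esub> a = a \<otimes>\<^bsub>G Mod H\<^esub> c"
      unfolding a_def c_def using x y cx by (intro rcos_commute) simp_all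
    show "c \<otimes>\<^bsub>G Mod H\<^esub> b = b \<otimes>\<^bsub>G Mod H\<^esub> c"
      unfolding b_def c_def using x y cy by (intro rcos_commute) simp_all
  qed simp_all
  moreover have "b [^]\<^bsub>G Mod H\<^esub> p \<otimes>\<^bsub>G Mod H\<^esub> a = a \<otimes>\<^bsub>G Mod H\<^esub> b [^]\<^bsub>G Mod H\<^esub> p"
    using rcos_commute [OF _ _ yp] x y by (simp add: a_def b_def rcos_pow del: mult_FactGroup)
  ultimately have "c [^]\<^bsub>G Mod H\<^esub> p = \<one>\<^bsub>G Mod H\<^esub>"
    by (simp add: Q.m_assoc del: mult_FactGroup one_FactGroup)
  then show ?thesis
    using x y by (simp add: c_def rcos_one_iff flip: rcos_pow)
qed

end

context group
begin

lemma normal_if_commutator_closed: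
  assumes "subgroup H G" "\<And>g h. g \<in> carrier G \<Longrightarrow> h \<in> H \<Longrightarrow> commutator G g h \<in> H"
  shows "H \<lhd> G"
proof (subst normal_inv_iff, intro conjI ballI)
  fix g h assume g: "g \<in> carrier G" and h: "h \<in> H"
  then have [simp]: "h \<in> carrier G"
    using subgroup.mem_carrier [OF assms(1)] by simp
  have "g \<otimes> h \<otimes> inv g = commutator G g h \<otimes> h"
    using g by (simp add: commutator_def m_assoc)
  then show "g \<otimes> h \<otimes> inv g \<in> H"
    using subgroup.m_closed [OF assms(1) assms(2) [OF g h] h] by simp
qed (rule assms(1))

lemma pow_conj:
  assumes [simp]: "g \<in> carrier G" "x \<in> carrier G"
  shows "(g \<otimes> x \<otimes> inv g) [^] (n::nat) = g \<otimes> x [^] n \<otimes> inv g"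
proof (induction n)
  case (Suc n)
  have "inv g \<otimes> (g \<otimes> z) = z" if "z \<in> carrier G" for z
    using that by (simp flip: m_assoc)
  then have "(g \<otimes> x [^] n \<otimes> inv g) \<otimes> (g \<otimes> x \<otimes> inv g) = g \<otimes> x [^] Suc n \<otimes> inv g"
    by (simp add: m_assoc)
  then show ?case by (simp only: nat_pow_Suc Suc)
qed simp

end

text \<open>The abstract form serves two series: \<open>exponent_p_series\<close> in
  \<open>G\<close>, and the preimages of its terms in a central extension of \<open>G\<close>, all
  of which contain the kernel.\<close>

locale p_central_series = group G for G (structure) +
  fixes p :: nat and N :: "nat \<Rightarrow> 'a set"
  assumes N_subgroup: "subgroup (N i) G"
    and N_Suc_subset: "N (Suc i) \<subseteq> N i"
    and N_commutator: "g \<in> carrier G \<Longrightarrow> u \<in> N i \<Longrightarrow> commutator G g u \<in> N (Suc i)"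
    and N_pow: "u \<in> N i \<Longrightarrow> u [^] p \<in> N (Suc i)"
begin

lemma N_carrier [simp]: "u \<in> N i \<Longrightarrow> u \<in> carrier G"
  by (rule subgroup.mem_carrier [OF N_subgroup])

lemma N_commutator': "u \<in> N i \<Longrightarrow> g \<in> carrier G \<Longrightarrow> commutator G u g \<in> N (Suc i)"
  using inv_commutator [of g u] subgroup.m_inv_closed [OF N_subgroup N_commutator [of g u i]]
  by simp

lemma N_normal: "N i \<lhd> G"
  using N_commutator N_Suc_subset by (intro normal_if_commutator_closed [OF N_subgroup]) blast

lemma N_antimono: "i \<le> j \<Longrightarrow> N j \<subseteq> N i"
  by (rule lift_Suc_antimono_le [of N]) (use N_Suc_subset in auto)

lemma N_pow_pow: "u \<in> N i \<Longrightarrow> u [^] (p ^ k) \<in> N (i + k)"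
proof (induction k)
  case (Suc k)
  have "u [^] (p ^ Suc k) = (u [^] (p ^ k)) [^] p"
    using Suc.prems by (simp add: nat_pow_pow mult.commute)
  then show ?case using Suc N_pow by simp
qed simp

text \<open>The commutators of \<open>commutator G y x\<close> with \<open>x\<close> and
  \<open>y\<close>, and its \<open>p\<close>-th power, lie one term further down, which is what the
  formula for odd powers requires.\<close>

lemma odd_pow_mult_N:
  assumes "odd p" and x: "x \<in> carrier G" and y: "y \<in> carrier G"
    and c: "commutator G y x \<in> N (Suc i)"
  shows "N (Suc (Suc i)) #> (x \<otimes> y) [^] p = N (Suc (Suc i)) #> (x [^] p \<otimes> y [^] p)"
  using assms N_commutator' [OF c] N_pow [OF c] by (intro normal.odd_pow_mult_rcos [OF N_normal])

text \<open>The \<open>p ^ k\<close>-th power map on \<open>N (i + 1)\<close> is a homomorphism into the centre, hence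
  invariant under conjugation, so that its kernel \<open>K\<close> contains all \<open>[G, N (i + 1)]\<close>. Modulo \<open>K\<close>
  the subgroup \<open>N i\<close> has class at most two, and \<open>[y, x] ^ p\<close> vanishes there since \<open>y ^ p\<close>
  lies in \<open>N (i + 1)\<close>.\<close>

lemma pow_mult_of_central:
  assumes "odd p" and central: "\<And>z g. z \<in> N e \<Longrightarrow> g \<in> carrier G \<Longrightarrow> z \<otimes> g = g \<otimes> z"
  shows "i + k = e \<Longrightarrow> x \<in> N i \<Longrightarrow> y \<in> N i \<Longrightarrow>
    (x \<otimes> y) [^] (p ^ k) = x [^] (p ^ k) \<otimes> y [^] (p ^ k)"
proof (induction k arbitrary: i x y)
  case 0
  then show ?case by simp
next
  case (Suc k)
  define q where "q = p ^ k"
  define K where "K = {u \<in> N (Suc i). u [^] q = \<one>}"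
  have hom: "(u \<otimes> v) [^] q = u [^] q \<otimes> v [^] q" if "u \<in> N (Suc i)" "v \<in> N (Suc i)" for u v
    using Suc.IH [of "Suc i" u v] Suc.prems that by (simp add: q_def)
  have cent: "u [^] q \<otimes> g = g \<otimes> u [^] q" if "u \<in> N (Suc i)" "g \<in> carrier G" for u g
    using N_pow_pow [of u "Suc i" k] Suc.prems that central by (simp add: q_def)
  interpret NS: subgroup "N (Suc i)" G by (rule N_subgroup)
  have K_sub: "subgroup K G"
  proof (rule subgroup.intro)
    fix u v assume "u \<in> K" "v \<in> K"
    then show "u \<otimes> v \<in> K" by (simp add: K_def hom)
  next
    fix u assume "u \<in> K"
    then show "inv u \<in> K" by (simp add: K_def nat_pow_inv)
  qed (auto simp: K_def)
  have comm_K: "commutator G g u \<in> K" if "g \<in> carrier G" "u \<in> N (Suc i)" for g u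
  proof -
    have "commutator G g u \<in> N (Suc i)"
      using that N_commutator N_Suc_subset by blast
    have "g \<otimes> u \<otimes> inv g \<in> N (Suc i)"
      using that normal.inv_op_closed2 [OF N_normal] by simp
    then have "commutator G g u [^] q = (g \<otimes> u \<otimes> inv g) [^] q \<otimes> (inv u) [^] q"
      unfolding commutator_def using that by (intro hom) auto
    also have "\<dots> = g \<otimes> u [^] q \<otimes> inv g \<otimes> inv (u [^] q)"
      using that by (simp add: pow_conj nat_pow_inv)
    also have "\<dots> = \<one>"
      unfolding cent [OF that(2,1), symmetric] using that by (simp add: m_assoc)
    finally show ?thesis using \<open>commutator G g u \<in> N (Suc i)\<close> by (simp add: K_def)
  qed
  have comm_K': "commutator G u g \<in> K" if "g \<in> carrier G" "u \<in> N (Suc i)" for g u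
    using subgroup.m_inv_closed [OF K_sub comm_K [OF that]] that by (simp add: inv_commutator)
  have K_normal: "K \<lhd> G"
    using comm_K by (intro normal_if_commutator_closed [OF K_sub]) (auto simp: K_def)
  have [simp]: "x \<in> carrier G" "y \<in> carrier G" using Suc.prems by auto
  have c: "commutator G y x \<in> N (Suc i)" using Suc.prems by (intro N_commutator) simp_all
  have "commutator G y x [^] p \<in> K"
    using comm_K' c N_pow Suc.prems by (intro normal.commutator_pow_rcos [OF K_normal]) auto
  then have "K #> (x \<otimes> y) [^] p = K #> (x [^] p \<otimes> y [^] p)"
    using comm_K' c \<open>odd p\<close> by (intro normal.odd_pow_mult_rcos [OF K_normal]) auto
  \<comment> \<open>\<open>?d\<close> measures how far the \<open>p\<close>-th power is from being
    multiplicative at \<open>x\<close> and \<open>y\<close>. Since it lies in \<open>K\<close>, the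
    remaining \<open>q\<close>-th power removes it.\<close>
  then have d: "(x \<otimes> y) [^] p \<otimes> inv (x [^] p \<otimes> y [^] p) \<in> K" (is "?d \<in> K")
    by (simp add: normal.rcos_eq_iff [OF K_normal])
  have "(x \<otimes> y) [^] (p ^ Suc k) = (?d \<otimes> (x [^] p \<otimes> y [^] p)) [^] q"
    by (simp add: q_def m_assoc nat_pow_pow)
  also have "\<dots> = ?d [^] q \<otimes> (x [^] p \<otimes> y [^] p) [^] q"
    using d Suc.prems N_pow by (intro hom) (auto simp: K_def)
  also have "\<dots> = (x [^] p) [^] q \<otimes> (y [^] p) [^] q"
    using d Suc.prems N_pow by (simp add: K_def hom)
  also have "\<dots> = x [^] (p ^ Suc k) \<otimes> y [^] (p ^ Suc k)"
    by (simp add: q_def nat_pow_pow)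
  finally show ?case .
qed

end

section \<open>The lower exponent-\<open>p\<close> central series of a powerful group\<close>

primrec exponent_p_series :: "nat \<Rightarrow> ('a, 'b) monoid_scheme \<Rightarrow> nat \<Rightarrow> 'a set" where
  "exponent_p_series p G 0 = carrier G"
| "exponent_p_series p G (Suc i) =
    generate G ({u [^]\<^bsub>G\<^esub> p |u. u \<in> exponent_p_series p G i} \<union>
      {commutator G g u |g u. g \<in> carrier G \<and> u \<in> exponent_p_series p G i})"

declare exponent_p_series.simps(2) [simp del]

context group
begin

text \<open>Normality and descent are proved together. Once a term lies in its predecessor, the
  commutators and \<open>p\<close>-th powers of its elements are among its own generators; this
  makes it normal and places the following term inside it.\<close>

lemma exponent_p_series_normal:
  "exponent_p_series p G i \<lhd> G \<and> exponent_p_series p G (Suc i) \<subseteq> exponent_p_series p G i"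
proof (induction i)
  case 0
  have "carrier G \<lhd> G"
    by (rule normal_if_commutator_closed) (simp_all add: subgroup_self)
  moreover have "exponent_p_series p G (Suc 0) \<subseteq> carrier G"
    unfolding exponent_p_series.simps by (rule generate_incl) auto
  ultimately show ?case by simp
next
  case (Suc i)
  let ?N = "exponent_p_series p G i" and ?M = "exponent_p_series p G (Suc i)"
  let ?S = "{u [^] p |u. u \<in> ?N} \<union> {commutator G g u |g u. g \<in> carrier G \<and> u \<in> ?N}"
  have N: "subgroup ?N G"
    using Suc by (simp add: normal_imp_subgroup)
  have M: "subgroup ?M G"
    unfolding exponent_p_series.simps(2)
    by (rule generate_is_subgroup) (auto simp: subgroup.mem_carrier [OF N])
  have gens: "?S \<subseteq> ?M"
    unfolding exponent_p_series.simps(2) by (auto intro: generate.incl)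
  have sub: "?M \<subseteq> ?N" using Suc by blast
  have "?M \<lhd> G"
    by (rule normal_if_commutator_closed [OF M]) (use gens sub in blast)
  moreover have "exponent_p_series p G (Suc (Suc i)) \<subseteq> ?M"
    unfolding exponent_p_series.simps(2) [of p G "Suc i"]
    by (rule generate_subgroup_incl [OF _ M]) (use gens sub in blast)
  ultimately show ?case by blast
qed

lemma exponent_p_series_p_central_series: "p_central_series G p (exponent_p_series p G)"
proof (intro p_central_series.intro p_central_series_axioms.intro is_group)
  fix i
  show "subgroup (exponent_p_series p G i) G" "exponent_p_series p G (Suc i) \<subseteq> exponent_p_series p G i"
    using exponent_p_series_normal normal_imp_subgroup by blast+
qed (auto simp: exponent_p_series.simps(2) intro: generate.incl)

text \<open>If \<open>G' \<le> \<mho>(G)\<close> then each term of the series consists, modulo the term after the next one,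
  of \<open>p\<close>-th powers of elements of the previous term.\<close>

lemma powerful_exponent_p_series_pow:
  assumes "odd p" and powerful: "powerful p G"
  shows "x \<in> exponent_p_series p G (Suc i) \<Longrightarrow> \<exists>u \<in> exponent_p_series p G i.
    exponent_p_series p G (Suc (Suc i)) #> x = exponent_p_series p G (Suc (Suc i)) #> u [^] p"
proof (induction i arbitrary: x)
  interpret p_central_series G p "exponent_p_series p G"
    by (rule exponent_p_series_p_central_series)
  let ?N = "exponent_p_series p G"
  \<comment> \<open>As \<open>A i\<close> turns out to be a subgroup, it is enough to find the
    generators of \<open>?N (Suc i)\<close> in it. The \<open>p\<close>-th powers are there by
    definition, so only commutators remain.\<close>
  define A where "A i = {x \<in> carrier G. \<exists>u \<in> ?N i. ?N (Suc (Suc i)) #> x = ?N (Suc (Suc i)) #> u [^] p}" for i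
  have A: "subgroup (A i) G" for i
  proof -
    let ?K = "?N (Suc (Suc i))"
    interpret K: normal ?K G by (rule N_normal)
    interpret Ni: subgroup "?N i" G by (rule N_subgroup)
    interpret h: group_hom G "G Mod ?K" "(#>) ?K" by (rule K.group_hom_rcos)
    show ?thesis
    proof (rule subgroup.intro)
      fix x y assume "x \<in> A i" "y \<in> A i"
      then obtain u v where [simp]: "x \<in> carrier G" "y \<in> carrier G" and uv: "u \<in> ?N i" "v \<in> ?N i"
        and eq: "?K #> x = ?K #> u [^] p" "?K #> y = ?K #> v [^] p"
        by (auto simp: A_def)
      have "?K #> (x \<otimes> y) = ?K #> (u [^] p \<otimes> v [^] p)"
        using uv eq by (simp add: K.rcos_mult del: mult_FactGroup)
      also have "\<dots> = ?K #> (u \<otimes> v) [^] p"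
        using uv \<open>odd p\<close> N_commutator by (intro odd_pow_mult_N [symmetric]) auto
      finally show "x \<otimes> y \<in> A i"
        using uv by (auto simp: A_def)
    next
      show "\<one> \<in> A i"
        by (auto simp: A_def intro!: bexI [of _ \<one>])
    next
      fix x assume "x \<in> A i"
      then obtain u where [simp]: "x \<in> carrier G" and u: "u \<in> ?N i" and eq: "?K #> x = ?K #> u [^] p"
        by (auto simp: A_def)
      have "?K #> inv x = ?K #> (inv u) [^] p"
        using u eq by (simp add: h.hom_inv nat_pow_inv)
      then show "inv x \<in> A i"
        using u by (auto simp: A_def)
    qed (auto simp: A_def)
  qed
  have pow_A: "u [^] p \<in> A i" if "u \<in> ?N i" for u i
    using that by (auto simp: A_def)
  have gen_A: "?N (Suc i) \<subseteq> A i"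
    if "\<And>g u. g \<in> carrier G \<Longrightarrow> u \<in> ?N i \<Longrightarrow> commutator G g u \<in> A i" for i
    unfolding exponent_p_series.simps(2)
    by (rule generate_subgroup_incl [OF _ A]) (use pow_A that in blast)
  {
    case 0
    have "commutator G g u \<in> A 0" if "g \<in> carrier G" "u \<in> ?N 0" for g u
    proof -
      have "commutator G g u \<in> derived G (carrier G)"
        unfolding derived_def commutator_def using that by (intro generate.incl) auto
      also have "\<dots> \<subseteq> agemo p G"
        using powerful by (simp add: powerful_def)
      also have "\<dots> \<subseteq> A 0"
        unfolding agemo_def by (rule generate_subgroup_incl [OF _ A]) (use pow_A [of _ 0] in auto)
      finally show ?thesis .
    qed
    then have "x \<in> A 0" using gen_A [of 0] 0 by blast
    then show ?case by (simp add: A_def)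
  next
    case (Suc i)
    let ?K = "?N (Suc (Suc (Suc i)))"
    interpret K: normal ?K G by (rule N_normal)
    have "commutator G g x \<in> A (Suc i)" if g: "g \<in> carrier G" and x: "x \<in> ?N (Suc i)" for g x
    proof -
      obtain u where u: "u \<in> ?N i" and eq: "?N (Suc (Suc i)) #> x = ?N (Suc (Suc i)) #> u [^] p"
        using Suc.IH x by blast
      \<comment> \<open>Modulo \<open>?K\<close> the commutator of \<open>g\<close> and
        \<open>x\<close> will become \<open>c ^ p\<close>. The factor \<open>w\<close> of
        \<open>x = w v\<close> drops out, the commutator of \<open>g\<close> and \<open>v\<close> is
        \<open>(c u) ^ p\<close> times the inverse of \<open>v\<close>, and \<open>(c u) ^ p\<close>
        may be replaced by \<open>c ^ p v\<close>.\<close>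
      define w where "w = x \<otimes> inv (u [^] p)"
      define v where "v = u [^] p"
      define c where "c = commutator G g u"
      have [simp]: "g \<in> carrier G" "x \<in> carrier G" "u \<in> carrier G" "v \<in> carrier G"
          "w \<in> carrier G" "c \<in> carrier G"
        using g x u by (simp_all add: w_def v_def c_def)
      have w: "w \<in> ?N (Suc (Suc i))"
        using eq normal.rcos_eq_iff [OF N_normal] by (simp add: w_def)
      have xw: "x = w \<otimes> v"
        by (simp add: w_def v_def m_assoc)
      have c: "c \<in> ?N (Suc i)"
        unfolding c_def using g u by (rule N_commutator)
      have cancel: "inv a \<otimes> (a \<otimes> b) = b" "a \<otimes> (inv a \<otimes> b) = b" if "a \<in> carrier G" "b \<in> carrier G" for a b
        using that by (simp_all flip: m_assoc)
      \<comment> \<open>In brackets: \<open>[g, w v] = [g, w] [w, [g, v]] [g, v]\<close>. The first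
        two factors lie in \<open>?K\<close> because \<open>w\<close> lies in the term before
        it.\<close>
      have "commutator G g x
          = commutator G g w \<otimes> (commutator G w (commutator G g v) \<otimes> commutator G g v)"
        by (simp add: xw commutator_def inv_mult_group m_assoc cancel)
      then have "?K #> commutator G g x = ?K #> commutator G g v"
        using N_commutator [OF g w] N_commutator' [OF w, of "commutator G g v"]
        by (simp add: K.rcos_absorb)
      also have "commutator G g v = (g \<otimes> u \<otimes> inv g) [^] p \<otimes> inv v"
        by (simp add: commutator_def v_def pow_conj)
      also have "g \<otimes> u \<otimes> inv g = c \<otimes> u"
        by (simp add: c_def commutator_def m_assoc)
      also have "?K #> ((c \<otimes> u) [^] p \<otimes> inv v) = ?K #> (c [^] p \<otimes> v \<otimes> inv v)"
        using odd_pow_mult_N [OF \<open>odd p\<close> _ _ N_commutator [OF _ c], of u]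
        by (simp add: K.rcos_mult v_def del: mult_FactGroup)
      also have "c [^] p \<otimes> v \<otimes> inv v = c [^] p"
        by (simp add: m_assoc)
      finally show ?thesis
        using c g x unfolding A_def by (simp) blast
    qed
    then have "x \<in> A (Suc i)" using gen_A [of "Suc i"] Suc.prems by blast
    then show ?case by (simp add: A_def)
  }
qed

text \<open>Each step down the series gains one factor \<open>p\<close> in the exponent: if
  \<open>x\<close> is \<open>u ^ p\<close> and \<open>u\<close> is \<open>w y ^ (p ^ i)\<close> with
  \<open>w\<close> in the next term, then taking the \<open>p\<close>-th power pushes
  \<open>w\<close> into \<open>?K\<close>, and \<open>y ^ (p ^ (i + 1))\<close> remains.\<close>

lemma powerful_exponent_p_series_pow_pow:
  assumes "odd p" and powerful: "powerful p G"
  shows "x \<in> exponent_p_series p G i \<Longrightarrow> \<exists>y \<in> carrier G.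
    exponent_p_series p G (Suc i) #> x = exponent_p_series p G (Suc i) #> y [^] (p ^ i)"
proof (induction i arbitrary: x)
  case 0
  then show ?case by (intro bexI [of _ x]) simp_all
next
  case (Suc i)
  interpret p_central_series G p "exponent_p_series p G"
    by (rule exponent_p_series_p_central_series)
  let ?N = "exponent_p_series p G"
  let ?K = "?N (Suc (Suc i))"
  interpret K: normal ?K G by (rule N_normal)
  obtain u where u: "u \<in> ?N i" and xu: "?K #> x = ?K #> u [^] p"
    using powerful_exponent_p_series_pow [OF assms Suc.prems] by blast
  obtain y where [simp]: "y \<in> carrier G" and uy: "?N (Suc i) #> u = ?N (Suc i) #> y [^] (p ^ i)"
    using Suc.IH [OF u] by blast
  define w where "w = u \<otimes> inv (y [^] (p ^ i))"
  have [simp]: "u \<in> carrier G" using u by simp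
  have w: "w \<in> ?N (Suc i)"
    using uy normal.rcos_eq_iff [OF N_normal] by (simp add: w_def)
  have uw: "u = w \<otimes> y [^] (p ^ i)"
    by (simp add: w_def m_assoc)
  have [simp]: "w \<in> carrier G" using w by simp
  have "commutator G (y [^] (p ^ i)) w \<in> ?N (Suc i)"
    by (rule subsetD [OF N_Suc_subset N_commutator [OF _ w]]) simp
  then have "?K #> u [^] p = ?K #> (w [^] p \<otimes> (y [^] (p ^ i)) [^] p)"
    unfolding uw by (intro odd_pow_mult_N [OF \<open>odd p\<close>]) simp_all
  also have "\<dots> = ?K #> (y [^] (p ^ i)) [^] p"
    using N_pow [OF w] by (simp add: K.rcos_absorb)
  also have "(y [^] (p ^ i)) [^] p = y [^] (p ^ Suc i)"
    by (simp add: nat_pow_pow mult.commute)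
  finally show ?case
    using xu by (intro bexI [of _ y]) simp_all
qed

section \<open>Finite \<open>p\<close>-groups: the series reaches the identity\<close>

lemma p_group_nontrivial_center:
  assumes p: "Factorial_Ring.prime p" and ord: "order G = p ^ k" and "k > 0"
  shows "\<exists>z \<in> carrier G. z \<noteq> \<one> \<and> (\<forall>g \<in> carrier G. g \<otimes> z = z \<otimes> g)"
proof (rule ccontr)
  assume no: "\<not> ?thesis"
  have noz: "\<exists>g \<in> carrier G. g \<otimes> z \<noteq> z \<otimes> g" if "z \<in> carrier G" "z \<noteq> \<one>" for z
    using no that by blast
  define \<phi> where "\<phi> = (\<lambda>g. \<lambda>h \<in> carrier G. g \<otimes> h \<otimes> inv g)"
  interpret conj: group_action G "carrier G" \<phi>
    unfolding \<phi>_def by (rule action_by_conjugation)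
  let ?O = "orbits G (carrier G) \<phi> - {{\<one>}}"
  have fin: "finite (carrier G)"
    using ord prime_gt_0_nat [OF p] by (simp flip: order_gt_0_iff_finite)
  have orb: "orbit G \<phi> x = (\<lambda>g. g \<otimes> x \<otimes> inv g) ` carrier G" if "x \<in> carrier G" for x
    using that by (auto simp: orbit_def \<phi>_def)
  have "orbit G \<phi> \<one> = {\<one>}"
    by (auto simp: orb)
  \<comment> \<open>Class equation: if only the identity is central, the size of every other class
    is a power of \<open>p\<close> different from 1. These classes partition the non-identity
    elements, so \<open>p\<close> would divide \<open>p ^ k - 1\<close>.\<close>
  have dvd: "p dvd card c" if c: "c \<in> ?O" for c
  proof -
    obtain x where x: "x \<in> carrier G" and cx: "c = orbit G \<phi> x"
      using c by (auto simp: orbits_def)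
    have "x \<noteq> \<one>"
      using c cx \<open>orbit G \<phi> \<one> = {\<one>}\<close> by blast
    then obtain g where g: "g \<in> carrier G" "g \<otimes> x \<noteq> x \<otimes> g"
      using noz x by blast
    have "card c dvd p ^ k"
      using conj.orbit_stabilizer_theorem [OF x] ord cx by (metis dvd_triv_left)
    moreover have "card c \<noteq> 1"
    proof
      assume "card c = 1"
      then obtain y where y: "c = {y}" by (rule card_1_singletonE)
      have "x \<in> c" using conj.orbit_refl [OF x] cx by simp
      moreover have "g \<otimes> x \<otimes> inv g \<in> c" using g x by (simp add: cx orb)
      ultimately have "g \<otimes> x \<otimes> inv g = x" using y by simp
      then show False using g x by (simp add: inv_solve_right')
    qed
    ultimately show ?thesis
      using divides_primepow_nat [OF p, of "card c" k] by (metis dvd_power gr0I power_0)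
  qed
  have part: "partition (carrier G) (orbits G (carrier G) \<phi>)"
    by (rule conj.orbit_partition)
  have union: "\<Union>?O = carrier G - {\<one>}"
  proof
    show "\<Union>?O \<subseteq> carrier G - {\<one>}"
    proof
      fix y assume "y \<in> \<Union>?O"
      then obtain x where x: "x \<in> carrier G" "y \<in> orbit G \<phi> x" "orbit G \<phi> x \<noteq> {\<one>}"
        by (auto simp: orbits_def)
      then obtain g where g: "g \<in> carrier G" "y = g \<otimes> x \<otimes> inv g"
        by (auto simp: orb)
      have "x = \<one>" if "y = \<one>"
        using that g x by (simp add: inv_solve_right')
      then show "y \<in> carrier G - {\<one>}"
        using g x \<open>orbit G \<phi> \<one> = {\<one>}\<close> by auto
    qed
    show "carrier G - {\<one>} \<subseteq> \<Union>?O"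
    proof
      fix x assume x: "x \<in> carrier G - {\<one>}"
      then have "x \<in> orbit G \<phi> x" using conj.orbit_refl by simp
      then show "x \<in> \<Union>?O" using x by (auto simp: orbits_def)
    qed
  qed
  have "p dvd card (\<Union>?O)"
  proof (rule dvd_partition)
    show "finite (\<Union>?O)" unfolding union using fin by simp
    show "\<forall>c1 \<in> ?O. \<forall>c2 \<in> ?O. c1 \<noteq> c2 \<longrightarrow> c1 \<inter> c2 = {}"
      using conj.disjoint_union by blast
  qed (use dvd in blast)
  then have "p dvd p ^ k - 1"
    unfolding union using fin ord by (simp add: order_def)
  moreover have "p dvd p ^ k" using \<open>k > 0\<close> by simp
  ultimately have "p dvd p ^ k - (p ^ k - 1)"
    by (rule dvd_diff_nat [rotated])
  then show False using p prime_gt_0_nat [OF p] by simp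
qed

end

lemma (in normal) commutator_mem_of_rcos_commute:
  assumes "x \<in> carrier G" "y \<in> carrier G"
    and "(H #> x) \<otimes>\<^bsub>G Mod H\<^esub> (H #> y) = (H #> y) \<otimes>\<^bsub>G Mod H\<^esub> (H #> x)"
  shows "commutator G x y \<in> H"
proof -
  have "H #> (x \<otimes> y) = H #> (y \<otimes> x)"
    using assms by (simp add: rcos_mult del: mult_FactGroup)
  then show ?thesis
    using assms by (simp add: rcos_eq_iff commutator_def inv_mult_group m_assoc)
qed

context group
begin

text \<open>For prime \<open>p\<close> this is Omega_1 of the centre. Commutators with
  \<open>G\<close> and \<open>p\<close>-th powers of its elements are trivial, so it provides one
  step of a central series of the required kind.\<close>

definition central_p_torsion :: "nat \<Rightarrow> 'a set" where
  "central_p_torsion p = {z \<in> carrier G. (\<forall>g \<in> carrier G. g \<otimes> z = z \<otimes> g) \<and> z [^] p = \<one>}"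

lemma central_p_torsionI:
  assumes "x \<in> carrier G" "\<And>g. g \<in> carrier G \<Longrightarrow> g \<otimes> x = x \<otimes> g" "x [^] p = \<one>"
  shows "x \<in> central_p_torsion p"
  unfolding central_p_torsion_def using assms by blast

lemma central_p_torsionD:
  assumes "x \<in> central_p_torsion p"
  shows "x \<in> carrier G" "g \<in> carrier G \<Longrightarrow> g \<otimes> x = x \<otimes> g" "x [^] p = \<one>"
  using assms unfolding central_p_torsion_def by blast+

lemma central_p_torsion_subgroup: "subgroup (central_p_torsion p) G"
proof (rule subgroup.intro)
  fix x y assume x: "x \<in> central_p_torsion p" and y: "y \<in> central_p_torsion p"
  note [simp] = central_p_torsionD(1) [OF x] central_p_torsionD(1) [OF y]
  show "x \<otimes> y \<in> central_p_torsion p"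
  proof (rule central_p_torsionI)
    fix g assume g: "g \<in> carrier G"
    have "g \<otimes> (x \<otimes> y) = (g \<otimes> x) \<otimes> y" using g by (simp add: m_assoc)
    also have "\<dots> = x \<otimes> (g \<otimes> y)" using g by (simp add: central_p_torsionD(2) [OF x g]) (simp add: m_assoc)
    also have "\<dots> = x \<otimes> y \<otimes> g" using g by (simp add: central_p_torsionD(2) [OF y g]) (simp add: m_assoc)
    finally show "g \<otimes> (x \<otimes> y) = x \<otimes> y \<otimes> g" .
  next
    have "(x \<otimes> y) [^] p = x [^] p \<otimes> y [^] p"
      by (rule pow_mult_distrib) (rule central_p_torsionD(2) [OF y], simp_all)
    then show "(x \<otimes> y) [^] p = \<one>"
      by (simp add: central_p_torsionD(3) [OF x] central_p_torsionD(3) [OF y])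
  qed simp
next
  fix x assume x: "x \<in> central_p_torsion p"
  note [simp] = central_p_torsionD(1) [OF x]
  show "inv x \<in> central_p_torsion p"
  proof (rule central_p_torsionI)
    fix g assume g: "g \<in> carrier G"
    have "x \<otimes> (g \<otimes> inv x) = (x \<otimes> g) \<otimes> inv x" using g by (simp add: m_assoc)
    also have "\<dots> = g" using g by (simp add: central_p_torsionD(2) [OF x g, symmetric] m_assoc)
    finally show "g \<otimes> inv x = inv x \<otimes> g" using g by (subst inv_solve_left) simp_all
  qed (simp_all add: nat_pow_inv central_p_torsionD(3) [OF x])
qed (auto intro: central_p_torsionI central_p_torsionD(1))

lemma p_group_central_p_torsion_nontrivial:
  assumes p: "Factorial_Ring.prime p" and ord: "order G = p ^ k" and "k > 0"
  shows "\<exists>z \<in> central_p_torsion p. z \<noteq> \<one>"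
proof -
  obtain z where z: "z \<in> carrier G" "z \<noteq> \<one>" and cen: "\<And>g. g \<in> carrier G \<Longrightarrow> g \<otimes> z = z \<otimes> g"
    using p_group_nontrivial_center [OF assms] by blast
  \<comment> \<open>The order of \<open>z\<close> is \<open>p ^ t\<close>, so the power of
    \<open>z\<close> with exponent \<open>p ^ (t - 1)\<close> is central of order
    \<open>p\<close>.\<close>
  define t where "t = (LEAST t. z [^] (p ^ t) = \<one>)"
  have t: "z [^] (p ^ t) = \<one>"
    unfolding t_def by (rule LeastI [of _ k]) (use z pow_order_eq_1 ord in metis)
  then have "t \<noteq> 0" using z by (metis nat_pow_eone power_0)
  then obtain s where s: "t = Suc s" using not0_implies_Suc by blast
  have "z [^] (p ^ s) \<noteq> \<one>"
    using not_less_Least [of s "\<lambda>t. z [^] (p ^ t) = \<one>"] s t_def by simp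
  moreover have "(z [^] (p ^ s)) [^] p = \<one>"
    using t z s by (simp add: nat_pow_pow mult.commute)
  moreover have "g \<otimes> z [^] (p ^ s) = z [^] (p ^ s) \<otimes> g" if "g \<in> carrier G" for g
    using pow_commute [of z g] cen z that by simp
  ultimately show ?thesis
    using z by (intro bexI [of _ "z [^] (p ^ s)"] central_p_torsionI) simp_all
qed

text \<open>Enlarge \<open>W\<close> to the preimage \<open>V\<close> of the central
  \<open>p\<close>-torsion of the quotient by \<open>W\<close>. By induction some term lies in
  \<open>V\<close>, and then the next term lies in \<open>W\<close>. The case of trivial
  \<open>W\<close> shows that the series ends in the identity.\<close>

lemma exponent_p_series_eventually_subset:
  assumes p: "Factorial_Ring.prime p" and ord: "order G = p ^ k" and "W \<lhd> G"
  shows "\<exists>m. exponent_p_series p G m \<subseteq> W"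
  using \<open>W \<lhd> G\<close>
proof (induction "card (carrier G - W)" arbitrary: W rule: less_induct)
  case less
  interpret W: normal W G by (rule less.prems)
  interpret Q: group "G Mod W" by (rule W.factorgroup_is_group)
  interpret h: group_hom G "G Mod W" "(#>) W" by (rule W.group_hom_rcos)
  have fin: "finite (carrier G)"
    using ord prime_gt_0_nat [OF p] by (simp flip: order_gt_0_iff_finite)
  show ?case
  proof (cases "W = carrier G")
    case True
    then show ?thesis by (metis exponent_p_series.simps(1) order_refl)
  next
    case False
    have lag: "order (G Mod W) * card W = p ^ k"
      using lagrange [OF W.subgroup_axioms] ord by (simp add: order_def FactGroup_def)
    then obtain j where j: "order (G Mod W) = p ^ j"
      using divides_primepow_nat [OF p] by (metis dvd_triv_left)
    have "j \<noteq> 0"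
    proof
      assume "j = 0"
      then have "card W = card (carrier G)" using lag j ord by (simp add: order_def)
      then show False using False fin W.subset by (simp add: card_subset_eq)
    qed
    then obtain z where z: "z \<in> Q.central_p_torsion p" "z \<noteq> \<one>\<^bsub>G Mod W\<^esub>"
      using Q.p_group_central_p_torsion_nontrivial [OF p j] by blast
    define V where "V = {x \<in> carrier G. W #> x \<in> Q.central_p_torsion p}"
    interpret T: subgroup "Q.central_p_torsion p" "G Mod W"
      by (rule Q.central_p_torsion_subgroup)
    have comm: "commutator G g x \<in> W" if "g \<in> carrier G" "x \<in> V" for g x
      using that Q.central_p_torsionD(2) [of "W #> x" p "W #> g"]
      by (intro W.commutator_mem_of_rcos_commute) (simp_all add: V_def del: mult_FactGroup)
    have pow: "x [^] p \<in> W" if "x \<in> V" for x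
      using that Q.central_p_torsionD(3) [of "W #> x" p]
      by (simp add: V_def W.rcos_one_iff flip: W.rcos_pow)
    have V: "subgroup V G"
      by (rule subgroup.intro)
        (auto simp: V_def W.rcos_mult h.hom_inv T.m_closed T.m_inv_closed T.one_closed
           simp del: mult_FactGroup one_FactGroup)
    have WV: "W \<subseteq> V"
    proof
      fix x assume "x \<in> W"
      then show "x \<in> V"
        using T.one_closed W.rcos_one_iff [of x] by (simp add: V_def)
    qed
    have "V \<lhd> G"
      by (rule normal_if_commutator_closed [OF V]) (use comm WV in blast)
    moreover have "card (carrier G - V) < card (carrier G - W)"
    proof (rule psubset_card_mono)
      obtain x where "x \<in> carrier G" "z = W #> x"
        using Q.central_p_torsionD(1) [OF z(1)] by (auto simp: carrier_FactGroup)
      then have "x \<in> V" "x \<notin> W" "x \<in> carrier G"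
        using z by (auto simp: V_def W.rcos_one_iff)
      then show "carrier G - V \<subset> carrier G - W"
        using WV by blast
    qed (use fin in simp)
    ultimately obtain m where m: "exponent_p_series p G m \<subseteq> V"
      using less.hyps by blast
    have "exponent_p_series p G (Suc m) \<subseteq> W"
      unfolding exponent_p_series.simps(2)
      by (rule generate_subgroup_incl [OF _ W.subgroup_axioms]) (use m comm pow in blast)
    then show ?thesis by blast
  qed
qed

text \<open>Modulo the next term, elements of the \<open>e\<close>-th term are
  \<open>p ^ e\<close>-th powers, hence trivial. So the series is constant from \<open>e\<close> on;
  as it reaches the identity, it has done so at \<open>e\<close>.\<close>

lemma powerful_exponent_p_series_trivial:
  assumes p: "Factorial_Ring.prime p" and "odd p" and ord: "order G = p ^ k" and pw: "powerful p G"
    and exp: "\<And>g. g \<in> carrier G \<Longrightarrow> g [^] (p ^ e) = \<one>"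
  shows "exponent_p_series p G e = {\<one>}"
proof -
  interpret p_central_series G p "exponent_p_series p G"
    by (rule exponent_p_series_p_central_series)
  let ?N = "exponent_p_series p G"
  have "?N e \<subseteq> ?N (Suc e)"
  proof
    fix x assume x: "x \<in> ?N e"
    then obtain y where "y \<in> carrier G" "?N (Suc e) #> x = ?N (Suc e) #> y [^] (p ^ e)"
      using powerful_exponent_p_series_pow_pow [OF \<open>odd p\<close> pw] by blast
    then show "x \<in> ?N (Suc e)"
      using x N_normal normal.rcos_eq_iff [OF N_normal, of x \<one>] by (simp add: exp)
  qed
  then have eq: "?N (Suc e) = ?N e"
    using N_Suc_subset by blast
  have const: "?N (e + d) = ?N e" for d
  proof (induction d)
    case (Suc d)
    have "?N (Suc (e + d)) = ?N (Suc e)"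
      unfolding exponent_p_series.simps(2) Suc ..
    then show ?case using eq by simp
  qed simp
  obtain m where "?N m \<subseteq> {\<one>}"
    using exponent_p_series_eventually_subset [OF p ord one_is_normal] by blast
  then have "?N e \<subseteq> {\<one>}"
    using subset_trans [OF N_antimono [OF le_add2 [of m e]]] by (simp add: const)
  then show ?thesis
    using subgroup.one_closed [OF N_subgroup] by blast
qed

end

section \<open>Extensions attached to cocycles\<close>

text \<open>The extension \<open>E\<close> from the beginning, the counterpart of
  \<open>cocycle_extension\<close> for a single cocycle: characters are replaced by their values at
  \<alpha>.\<close>

definition twisted_product ::
    "('a, 'b) monoid_scheme \<Rightarrow> ('a \<times> 'a \<Rightarrow> complex) \<Rightarrow> ('a \<times> complex) monoid" where
  "twisted_product G \<alpha> =
    \<lparr>carrier = carrier G \<times> (UNIV - {0}),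
     monoid.mult = (\<lambda>(g, a) (h, b). (g \<otimes>\<^bsub>G\<^esub> h, \<alpha> (g, h) * a * b)),
     one = (\<one>\<^bsub>G\<^esub>, 1)\<rparr>"

lemma twisted_product_simps [simp]:
  "(g, a) \<in> carrier (twisted_product G \<alpha>) \<longleftrightarrow> g \<in> carrier G \<and> a \<noteq> 0"
  "(g, a) \<otimes>\<^bsub>twisted_product G \<alpha>\<^esub> (h, b) = (g \<otimes>\<^bsub>G\<^esub> h, \<alpha> (g, h) * a * b)"
  "\<one>\<^bsub>twisted_product G \<alpha>\<^esub> = (\<one>\<^bsub>G\<^esub>, 1)"
  by (simp_all add: twisted_product_def)

context group
begin

lemma cocycle_groupD:
  assumes "\<alpha> \<in> carrier (cocycle_group G)"
  shows "x \<in> carrier G \<Longrightarrow> y \<in> carrier G \<Longrightarrow> \<alpha> (x, y) \<noteq> 0"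
    and "x \<in> carrier G \<Longrightarrow> y \<in> carrier G \<Longrightarrow> z \<in> carrier G \<Longrightarrow>
      \<alpha> (x, y) * \<alpha> (x \<otimes> y, z) = \<alpha> (x, y \<otimes> z) * \<alpha> (y, z)"
    and "\<alpha> (\<one>, \<one>) = 1"
    and "\<alpha> \<in> extensional (carrier G \<times> carrier G)"
  using assms by (auto simp: cocycle_group_def complex_units_def PiE_iff)

lemma cocycle_one:
  assumes "\<alpha> \<in> carrier (cocycle_group G)" "x \<in> carrier G"
  shows "\<alpha> (\<one>, x) = 1" "\<alpha> (x, \<one>) = 1"
  using cocycle_groupD(2) [OF assms(1), of \<one> \<one> x] cocycle_groupD(2) [OF assms(1), of x \<one> \<one>]
    cocycle_groupD(1,3) [OF assms(1)] assms(2) by auto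

lemma twisted_product_group:
  assumes \<alpha>: "\<alpha> \<in> carrier (cocycle_group G)"
  shows "group (twisted_product G \<alpha>)"
proof (rule groupI)
  note cocycle_groupD(1) [OF \<alpha>, simp] cocycle_one [OF \<alpha>, simp]
  fix x y z
  assume xyz: "x \<in> carrier (twisted_product G \<alpha>)" "y \<in> carrier (twisted_product G \<alpha>)"
    "z \<in> carrier (twisted_product G \<alpha>)"
  obtain g a where x: "x = (g, a)" by (cases x)
  obtain h b where y: "y = (h, b)" by (cases y)
  obtain k c where z: "z = (k, c)" by (cases z)
  have "\<alpha> (g \<otimes> h, k) * (\<alpha> (g, h) * a * b) * c = \<alpha> (g, h \<otimes> k) * a * (\<alpha> (h, k) * b * c)"
    using cocycle_groupD(2) [OF \<alpha>, of g h k] xyz x y z by (simp add: ac_simps)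
  then show "x \<otimes>\<^bsub>twisted_product G \<alpha>\<^esub> y \<otimes>\<^bsub>twisted_product G \<alpha>\<^esub> z
      = x \<otimes>\<^bsub>twisted_product G \<alpha>\<^esub> (y \<otimes>\<^bsub>twisted_product G \<alpha>\<^esub> z)"
    using xyz x y z by (simp add: m_assoc)
next
  note cocycle_groupD(1) [OF \<alpha>, simp]
  fix x assume "x \<in> carrier (twisted_product G \<alpha>)"
  then obtain g a where x: "x = (g, a)" "g \<in> carrier G" "a \<noteq> 0"
    by (cases x) auto
  then show "\<exists>y \<in> carrier (twisted_product G \<alpha>).
      y \<otimes>\<^bsub>twisted_product G \<alpha>\<^esub> x = \<one>\<^bsub>twisted_product G \<alpha>\<^esub>"
    by (intro bexI [of _ "(inv g, inverse (\<alpha> (inv g, g) * a))"]) (auto simp: field_simps)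
qed (use cocycle_groupD(1) [OF \<alpha>] cocycle_one [OF \<alpha>] in auto)

lemma twisted_product_pow:
  assumes \<alpha>: "\<alpha> \<in> carrier (cocycle_group G)" and g: "g \<in> carrier G" and a: "a \<noteq> 0"
  shows "(g, a) [^]\<^bsub>twisted_product G \<alpha>\<^esub> (n::nat) = (g [^] n, a ^ n * (\<Prod>j<n. \<alpha> (g, g [^] j)))"
proof (induction n)
  case (Suc n)
  interpret E: group "twisted_product G \<alpha>" by (rule twisted_product_group [OF \<alpha>])
  have "(g, a) [^]\<^bsub>twisted_product G \<alpha>\<^esub> Suc n
      = (g, a) \<otimes>\<^bsub>twisted_product G \<alpha>\<^esub> (g, a) [^]\<^bsub>twisted_product G \<alpha>\<^esub> n"
    using g a by (intro E.nat_pow_Suc2) simp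
  also have "\<dots> = (g [^] Suc n, a ^ Suc n * (\<Prod>j<Suc n. \<alpha> (g, g [^] j)))"
    using nat_pow_Suc2 [OF g, of n] by (simp add: Suc ac_simps)
  finally show ?case .
qed simp

section \<open>Unitary cocycles and powers in the unitary cover\<close>

lemma unitary_cocyclesD:
  assumes "\<alpha> \<in> unitary_cocycles G"
  shows "\<alpha> \<in> carrier (cocycle_group G)"
    "g \<in> carrier G \<Longrightarrow> (\<Prod>j<group.ord G g. \<alpha> (g, g [^] j)) = 1"
  using assms by (simp_all add: unitary_cocycles_def)

text \<open>By \<open>twisted_product_pow\<close>, unitarity of \<alpha> says that
  \<open>(g, 1)\<close> raised to the order of \<open>g\<close> is the identity; \<open>n\<close> is
  a multiple of this order.\<close>

lemma unitary_section_pow: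
  assumes \<alpha>: "\<alpha> \<in> unitary_cocycles G" and g: "g \<in> carrier G" and "g [^] (n::nat) = \<one>"
  shows "(g, 1) [^]\<^bsub>twisted_product G \<alpha>\<^esub> n = (\<one>, 1)"
proof -
  interpret E: group "twisted_product G \<alpha>"
    by (rule twisted_product_group [OF unitary_cocyclesD(1) [OF \<alpha>]])
  have o: "(g, 1) [^]\<^bsub>twisted_product G \<alpha>\<^esub> ord g = (\<one>, 1)"
    using g by (simp add: twisted_product_pow [OF unitary_cocyclesD(1) [OF \<alpha>]]
        unitary_cocyclesD(2) [OF \<alpha>])
  obtain m where "n = ord g * m"
    using assms pow_eq_id by (metis dvdE)
  then have "(g, 1) [^]\<^bsub>twisted_product G \<alpha>\<^esub> n
      = ((g, 1) [^]\<^bsub>twisted_product G \<alpha>\<^esub> ord g) [^]\<^bsub>twisted_product G \<alpha>\<^esub> m"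
    using g by (simp add: E.nat_pow_pow)
  also have "\<dots> = (\<one>, 1)"
    unfolding o using E.nat_pow_one [of m] by simp
  finally show ?thesis .
qed

lemma unitary_cocycles_one: "(\<lambda>p \<in> carrier G \<times> carrier G. 1) \<in> unitary_cocycles G"
  by (auto simp: unitary_cocycles_def cocycle_group_def complex_units_def)

lemma unitary_cocycles_mult:
  assumes "\<alpha> \<in> unitary_cocycles G" "\<beta> \<in> unitary_cocycles G"
  shows "(\<lambda>p \<in> carrier G \<times> carrier G. \<alpha> p * \<beta> p) \<in> unitary_cocycles G"
proof -
  note a = cocycle_groupD [OF unitary_cocyclesD(1) [OF assms(1)]]
    and b = cocycle_groupD [OF unitary_cocyclesD(1) [OF assms(2)]]
  have "\<alpha> (x, y) * \<beta> (x, y) * (\<alpha> (x \<otimes> y, z) * \<beta> (x \<otimes> y, z))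
      = \<alpha> (x, y \<otimes> z) * \<beta> (x, y \<otimes> z) * (\<alpha> (y, z) * \<beta> (y, z))"
    if "x \<in> carrier G" "y \<in> carrier G" "z \<in> carrier G" for x y z
    using arg_cong2 [OF a(2) [OF that] b(2) [OF that], of "(*)"] by (simp only: ac_simps)
  then show ?thesis
    using a(1,3) b(1,3) unitary_cocyclesD(2) [OF assms(1)] unitary_cocyclesD(2) [OF assms(2)]
    by (auto simp: unitary_cocycles_def cocycle_group_def complex_units_def prod.distrib)
qed

abbreviation unitary_dual :: "(('a \<times> 'a \<Rightarrow> complex) \<Rightarrow> complex) set" where
  "unitary_dual \<equiv> carrier (dual_group ((cocycle_group G)\<lparr>carrier := unitary_cocycles G\<rparr>))"

lemma mem_unitary_dual:
  "\<chi> \<in> unitary_dual \<longleftrightarrow> \<chi> \<in> extensional (unitary_cocycles G) \<and>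
    (\<forall>\<alpha> \<in> unitary_cocycles G. \<chi> \<alpha> \<noteq> 0) \<and>
    (\<forall>\<alpha> \<in> unitary_cocycles G. \<forall>\<beta> \<in> unitary_cocycles G.
      \<chi> (\<lambda>p \<in> carrier G \<times> carrier G. \<alpha> p * \<beta> p) = \<chi> \<alpha> * \<chi> \<beta>)"
  by (auto simp: dual_group_def hom_def complex_units_def cocycle_group_def)

lemma unitary_cover_simps:
  "carrier (unitary_cover G) = carrier G \<times> unitary_dual"
  "(g, \<chi>) \<otimes>\<^bsub>unitary_cover G\<^esub> (h, \<psi>)
    = (g \<otimes> h, \<lambda>\<alpha> \<in> unitary_cocycles G. \<alpha> (g, h) * \<chi> \<alpha> * \<psi> \<alpha>)"
  "\<one>\<^bsub>unitary_cover G\<^esub> = (\<one>, \<lambda>\<alpha> \<in> unitary_cocycles G. 1)"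
  by (simp_all add: unitary_cover_def cocycle_extension_def Let_def dual_group_def cong: restrict_cong)

lemma unitary_cover_pow:
  assumes g: "g \<in> carrier G" and \<chi>: "\<chi> \<in> unitary_dual"
  shows "\<exists>\<psi> \<in> unitary_dual. (g, \<chi>) [^]\<^bsub>unitary_cover G\<^esub> (n::nat) = (g [^] n, \<psi>) \<and>
    (\<forall>\<alpha> \<in> unitary_cocycles G. \<psi> \<alpha> = \<chi> \<alpha> ^ n * (\<Prod>j<n. \<alpha> (g, g [^] j)))"
proof (induction n)
  case 0
  show ?case
    by (auto simp: unitary_cover_simps mem_unitary_dual unitary_cocycles_mult)
next
  case (Suc n)
  then obtain \<psi> where \<psi>: "\<psi> \<in> unitary_dual"
    and pow: "(g, \<chi>) [^]\<^bsub>unitary_cover G\<^esub> n = (g [^] n, \<psi>)"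
    and eq: "\<And>\<alpha>. \<alpha> \<in> unitary_cocycles G \<Longrightarrow> \<psi> \<alpha> = \<chi> \<alpha> ^ n * (\<Prod>j<n. \<alpha> (g, g [^] j))"
    by blast
  define \<theta> where "\<theta> = (\<lambda>\<alpha> \<in> unitary_cocycles G. \<alpha> (g [^] n, g) * \<psi> \<alpha> * \<chi> \<alpha>)"
  have "\<theta> \<in> unitary_dual"
    using \<chi> \<psi> g cocycle_groupD(1) [OF unitary_cocyclesD(1)]
    by (auto simp: mem_unitary_dual \<theta>_def unitary_cocycles_mult)
  moreover have "\<theta> \<alpha> = \<chi> \<alpha> ^ Suc n * (\<Prod>j<Suc n. \<alpha> (g, g [^] j))"
    if \<alpha>: "\<alpha> \<in> unitary_cocycles G" for \<alpha>
  proof -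
    have 0: "\<chi> \<alpha> \<noteq> 0" using \<chi> \<alpha> by (simp add: mem_unitary_dual)
    \<comment> \<open>The recursion for powers multiplies on the right and yields
      \<open>\<alpha> (g [^] n, g)\<close>, while the claim contains
      \<open>\<alpha> (g, g [^] n)\<close>. Both formulas compute the same power in the group
      \<open>twisted_product G \<alpha>\<close>.\<close>
    note p = twisted_product_pow [OF unitary_cocyclesD(1) [OF \<alpha>] g 0]
    show ?thesis
      using p [of "Suc n"] \<alpha> by (simp add: p [of n] \<theta>_def eq del: prod.lessThan_Suc power_Suc)
  qed
  moreover have "(g, \<chi>) [^]\<^bsub>unitary_cover G\<^esub> Suc n = (g [^] Suc n, \<theta>)"
    by (simp add: pow unitary_cover_simps \<theta>_def)
  ultimately show ?case by blast
qed

lemma unitary_dual_pow: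
  assumes \<chi>: "\<chi> \<in> unitary_dual" and \<alpha>: "\<alpha> \<in> unitary_cocycles G"
  shows "(\<lambda>p \<in> carrier G \<times> carrier G. \<alpha> p ^ n) \<in> unitary_cocycles G \<and>
    \<chi> (\<lambda>p \<in> carrier G \<times> carrier G. \<alpha> p ^ n) = \<chi> \<alpha> ^ n"
proof (induction n)
  case 0
  have "\<chi> (\<lambda>p \<in> carrier G \<times> carrier G. 1) = 1"
  proof -
    let ?e = "\<lambda>p \<in> carrier G \<times> carrier G. 1 :: complex"
    have "\<chi> (\<lambda>p \<in> carrier G \<times> carrier G. ?e p * ?e p) = \<chi> ?e * \<chi> ?e"
      using \<chi> unitary_cocycles_one by (simp add: mem_unitary_dual del: restrict_apply)
    moreover have "(\<lambda>p \<in> carrier G \<times> carrier G. ?e p * ?e p) = ?e" by auto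
    moreover have "\<chi> ?e \<noteq> 0"
      using \<chi> unitary_cocycles_one by (simp add: mem_unitary_dual del: restrict_apply)
    ultimately show ?thesis by simp
  qed
  then show ?case using unitary_cocycles_one by (simp del: restrict_apply)
next
  case (Suc n)
  let ?b = "\<lambda>p \<in> carrier G \<times> carrier G. \<alpha> p ^ n"
  have b: "?b \<in> unitary_cocycles G" "\<chi> ?b = \<chi> \<alpha> ^ n" using Suc by blast+
  have eq: "(\<lambda>p \<in> carrier G \<times> carrier G. \<alpha> p * ?b p) = (\<lambda>p \<in> carrier G \<times> carrier G. \<alpha> p ^ Suc n)"
    by (rule restrict_ext) auto
  have "\<chi> (\<lambda>p \<in> carrier G \<times> carrier G. \<alpha> p * ?b p) = \<chi> \<alpha> * \<chi> ?b"
    using \<chi> \<alpha> b(1) unfolding mem_unitary_dual by blast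
  then show ?case
    using unitary_cocycles_mult [OF \<alpha> b(1)] b(2) unfolding eq by (simp del: restrict_apply)
qed

text \<open>From left to right, take the power of \<open>(\<one>, \<chi>)\<close> with \<chi> the
  evaluation at \<open>(g, h)\<close>. Conversely, \<open>\<chi> \<alpha> ^ n\<close> is the value
  of \<chi> at the trivial cocycle, and the remaining product is 1 by unitarity.\<close>

lemma unitary_cover_pow_eq_one_iff:
  "(\<forall>x \<in> carrier (unitary_cover G). x [^]\<^bsub>unitary_cover G\<^esub> (n::nat) = \<one>\<^bsub>unitary_cover G\<^esub>) \<longleftrightarrow>
    (\<forall>g \<in> carrier G. g [^] n = \<one>) \<and>
    (\<forall>\<alpha> \<in> unitary_cocycles G. \<forall>g \<in> carrier G. \<forall>h \<in> carrier G. \<alpha> (g, h) ^ n = 1)"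
    (is "?L \<longleftrightarrow> ?R1 \<and> ?R2")
proof
  assume L: ?L
  have eval: "(\<lambda>\<alpha> \<in> unitary_cocycles G. \<alpha> (g, h)) \<in> unitary_dual"
    if "g \<in> carrier G" "h \<in> carrier G" for g h
    using that cocycle_groupD(1) [OF unitary_cocyclesD(1)]
    by (auto simp: mem_unitary_dual unitary_cocycles_mult)
  have ev: "g [^] n = \<one> \<and> (\<forall>\<alpha> \<in> unitary_cocycles G. \<chi> \<alpha> ^ n * (\<Prod>j<n. \<alpha> (g, g [^] j)) = 1)"
    if mem: "g \<in> carrier G" "\<chi> \<in> unitary_dual" for g \<chi>
  proof -
    have "(g, \<chi>) [^]\<^bsub>unitary_cover G\<^esub> n = (\<one>, \<lambda>\<alpha> \<in> unitary_cocycles G. 1)"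
      using L mem by (simp add: unitary_cover_simps)
    moreover obtain \<psi> where "(g, \<chi>) [^]\<^bsub>unitary_cover G\<^esub> n = (g [^] n, \<psi>)"
      "\<forall>\<alpha> \<in> unitary_cocycles G. \<psi> \<alpha> = \<chi> \<alpha> ^ n * (\<Prod>j<n. \<alpha> (g, g [^] j))"
      using unitary_cover_pow [OF mem, of n] by blast
    ultimately show ?thesis by fastforce
  qed
  show "?R1 \<and> ?R2"
  proof (intro conjI ballI)
    fix g assume "g \<in> carrier G"
    then show "g [^] n = \<one>" using ev [OF _ eval] by blast
  next
    fix \<alpha> g h
    assume \<alpha>: "\<alpha> \<in> unitary_cocycles G" and gh: "g \<in> carrier G" "h \<in> carrier G"
    show "\<alpha> (g, h) ^ n = 1"
      using bspec [OF conjunct2 [OF ev [OF one_closed eval [OF gh]]] \<alpha>]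
        cocycle_groupD(3) [OF unitary_cocyclesD(1) [OF \<alpha>]] \<alpha> by simp
  qed
next
  assume R: "?R1 \<and> ?R2"
  show ?L
  proof
    fix x assume "x \<in> carrier (unitary_cover G)"
    then obtain g \<chi> where x: "x = (g, \<chi>)" and g: "g \<in> carrier G" and \<chi>: "\<chi> \<in> unitary_dual"
      by (auto simp: unitary_cover_simps)
    obtain \<psi> where \<psi>: "\<psi> \<in> unitary_dual" and pow: "x [^]\<^bsub>unitary_cover G\<^esub> n = (g [^] n, \<psi>)"
      and eq: "\<And>\<alpha>. \<alpha> \<in> unitary_cocycles G \<Longrightarrow> \<psi> \<alpha> = \<chi> \<alpha> ^ n * (\<Prod>j<n. \<alpha> (g, g [^] j))"
      using unitary_cover_pow [OF g \<chi>, of n] x by blast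
    have gn: "g [^] n = \<one>" using R g by blast
    have "\<psi> \<alpha> = 1" if \<alpha>: "\<alpha> \<in> unitary_cocycles G" for \<alpha>
    proof -
      have "(\<lambda>p \<in> carrier G \<times> carrier G. \<alpha> p ^ n) = (\<lambda>p \<in> carrier G \<times> carrier G. \<alpha> p ^ 0)"
        using R \<alpha> by (intro restrict_ext) auto
      then have "\<chi> \<alpha> ^ n = \<chi> \<alpha> ^ 0"
        using unitary_dual_pow [OF \<chi> \<alpha>, of n] unitary_dual_pow [OF \<chi> \<alpha>, of 0] by metis
      moreover have "(\<Prod>j<n. \<alpha> (g, g [^] j)) = 1"
        using unitary_section_pow [OF \<alpha> g gn]
          twisted_product_pow [OF unitary_cocyclesD(1) [OF \<alpha>] g, of 1 n] by simp
      ultimately show ?thesis using eq [OF \<alpha>] by simp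
    qed
    then have "\<psi> = (\<lambda>\<alpha> \<in> unitary_cocycles G. 1)"
      using \<psi> by (intro extensionalityI [of _ "unitary_cocycles G"]) (auto simp: mem_unitary_dual)
    then show "x [^]\<^bsub>unitary_cover G\<^esub> n = \<one>\<^bsub>unitary_cover G\<^esub>"
      using pow gn by (simp add: unitary_cover_simps)
  qed
qed

end

section \<open>Exponents and powerful groups\<close>

text \<open>Stated for arbitrary structures because it is applied to \<open>unitary_cover G\<close>,
  which is handled through the powers of its elements alone.\<close>

lemma group_exponent_eqI:
  assumes "0 < n" "\<And>x. x \<in> carrier G \<Longrightarrow> x [^]\<^bsub>G\<^esub> n = \<one>\<^bsub>G\<^esub>"
    and "\<And>m. 0 < m \<Longrightarrow> \<forall>x \<in> carrier G. x [^]\<^bsub>G\<^esub> m = \<one>\<^bsub>G\<^esub> \<Longrightarrow> n \<le> m"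
  shows "group_exponent G = n"
  unfolding group_exponent_def by (rule Least_equality) (use assms in auto)

context group
begin

lemma group_exponent_pow:
  assumes "finite (carrier G)"
  shows "0 < group_exponent G" "x \<in> carrier G \<Longrightarrow> x [^] group_exponent G = \<one>"
proof -
  have "0 < order G \<and> (\<forall>x \<in> carrier G. x [^] order G = \<one>)"
    using assms pow_order_eq_1 by (simp add: order_gt_0_iff_finite)
  then have "0 < group_exponent G \<and> (\<forall>x \<in> carrier G. x [^] group_exponent G = \<one>)"
    unfolding group_exponent_def by (rule LeastI)
  then show "0 < group_exponent G" "x \<in> carrier G \<Longrightarrow> x [^] group_exponent G = \<one>"
    by simp_all
qed

lemma group_exponent_dvd_iff:
  assumes "finite (carrier G)"
  shows "group_exponent G dvd n \<longleftrightarrow> (\<forall>x \<in> carrier G. x [^] n = \<one>)"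
proof
  assume "group_exponent G dvd n"
  then show "\<forall>x \<in> carrier G. x [^] n = \<one>"
    using group_exponent_pow(2) [OF assms] pow_eq_id by (meson dvd_trans)
next
  assume n: "\<forall>x \<in> carrier G. x [^] n = \<one>"
  define r where "r = n mod group_exponent G"
  have "x [^] r = \<one>" if x: "x \<in> carrier G" for x
    using n group_exponent_pow(2) [OF assms x] x unfolding r_def
    by (simp add: pow_eq_id dvd_mod)
  moreover have "r < group_exponent G"
    unfolding r_def using group_exponent_pow(1) [OF assms] by simp
  ultimately have "r = 0"
    using not_less_Least [of r "\<lambda>n. 0 < n \<and> (\<forall>x \<in> carrier G. x [^] n = \<one>)"]
    unfolding group_exponent_def by auto
  then show "group_exponent G dvd n"
    by (simp add: r_def dvd_eq_mod_eq_0)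
qed

lemma finite_p_group_exponent:
  assumes p: "Factorial_Ring.prime p" and "finite_p_group p G"
  obtains k e where "order G = p ^ k" "finite (carrier G)" "group_exponent G = p ^ e"
proof -
  obtain k where k: "order G = p ^ k" and fin: "finite (carrier G)"
    using assms by (auto simp: finite_p_group_def)
  then have "group_exponent G dvd p ^ k"
    unfolding group_exponent_dvd_iff [OF fin] using pow_order_eq_1 by simp
  then show ?thesis
    using that k fin divides_primepow_nat [OF p] by blast
qed

section \<open>The central extension of a powerful group\<close>

lemma twisted_product_central:
  assumes "\<alpha> \<in> carrier (cocycle_group G)" "x \<in> carrier (twisted_product G \<alpha>)" "a \<noteq> 0"
  shows "(\<one>, a) \<otimes>\<^bsub>twisted_product G \<alpha>\<^esub> x = x \<otimes>\<^bsub>twisted_product G \<alpha>\<^esub> (\<one>, a)"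
  using assms by (cases x) (simp add: cocycle_one)

lemma fst_twisted_product_hom:
  assumes "\<alpha> \<in> carrier (cocycle_group G)"
  shows "group_hom (twisted_product G \<alpha>) G fst"
  by (intro group_hom.intro group_hom_axioms.intro twisted_product_group assms is_group homI) auto

text \<open>The product is \<open>(g \<otimes> h, 1)\<close> times the central element with second
  component \<open>\<alpha> (g, h)\<close>, and the \<open>n\<close>-th power of
  \<open>(g \<otimes> h, 1)\<close> is trivial by unitarity.\<close>

lemma unitary_pow_of_mult:
  assumes \<alpha>: "\<alpha> \<in> unitary_cocycles G" and g: "g \<in> carrier G" and h: "h \<in> carrier G"
    and gh: "(g \<otimes> h) [^] (n::nat) = \<one>"
  shows "((g, 1) \<otimes>\<^bsub>twisted_product G \<alpha>\<^esub> (h, 1)) [^]\<^bsub>twisted_product G \<alpha>\<^esub> n = (\<one>, \<alpha> (g, h) ^ n)"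
proof -
  note \<alpha>' = unitary_cocyclesD(1) [OF \<alpha>]
  have "(\<Prod>j<n. \<alpha> (g \<otimes> h, (g \<otimes> h) [^] j)) = 1"
    using unitary_section_pow [OF \<alpha> _ gh] twisted_product_pow [OF \<alpha>', of "g \<otimes> h" 1 n] g h gh
    by simp
  then show ?thesis
    using twisted_product_pow [OF \<alpha>', of "g \<otimes> h" "\<alpha> (g, h)" n] cocycle_groupD(1) [OF \<alpha>' g h] g h gh
    by simp
qed

lemma powerful_unitary_cocycle_pow:
  assumes p: "Factorial_Ring.prime p" and "odd p" and ord: "order G = p ^ k" and pw: "powerful p G"
    and exp: "\<And>g. g \<in> carrier G \<Longrightarrow> g [^] (p ^ e) = \<one>"
    and \<alpha>: "\<alpha> \<in> unitary_cocycles G" and g: "g \<in> carrier G" and h: "h \<in> carrier G"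
  shows "\<alpha> (g, h) ^ (p ^ e) = 1"
proof -
  note \<alpha>' = unitary_cocyclesD(1) [OF \<alpha>]
  let ?E = "twisted_product G \<alpha>"
  interpret P: p_central_series G p "exponent_p_series p G"
    by (rule exponent_p_series_p_central_series)
  interpret \<pi>: group_hom ?E G fst by (rule fst_twisted_product_hom [OF \<alpha>'])
  \<comment> \<open>Preimages under the projection to \<open>G\<close>: \<open>N 0\<close> is the
    whole extension and \<open>N e\<close> is its central kernel, since the \<open>e\<close>-th term
    in \<open>G\<close> is trivial.\<close>
  define N where "N i = {x \<in> carrier ?E. fst x \<in> exponent_p_series p G i}" for i
  interpret E: p_central_series ?E p N
  proof (intro p_central_series.intro p_central_series_axioms.intro \<pi>.G.is_group)
    fix i
    interpret S: subgroup "exponent_p_series p G i" G by (rule P.N_subgroup)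
    show "subgroup (N i) ?E"
      by (rule subgroup.intro) (auto simp: N_def \<pi>.hom_inv)
    show "N (Suc i) \<subseteq> N i"
      using P.N_Suc_subset by (auto simp: N_def)
    show "commutator ?E x u \<in> N (Suc i)" if x: "x \<in> carrier ?E" and u: "u \<in> N i" for x u
    proof -
      have "u \<in> carrier ?E" using u by (simp add: N_def)
      then have "fst (commutator ?E x u) = commutator G (fst x) (fst u)"
        using x by (simp add: commutator_def \<pi>.hom_inv \<pi>.hom_mult del: twisted_product_simps(2))
      then show ?thesis
        using P.N_commutator [of "fst x" "fst u" i] x u by (simp add: N_def)
    qed
    show "u [^]\<^bsub>?E\<^esub> p \<in> N (Suc i)" if "u \<in> N i" for u
      using that P.N_pow [of "fst u" i] by (simp add: N_def \<pi>.hom_nat_pow)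
  qed
  have central: "z \<otimes>\<^bsub>?E\<^esub> x = x \<otimes>\<^bsub>?E\<^esub> z" if z: "z \<in> N e" and x: "x \<in> carrier ?E" for z x
  proof -
    obtain a where "z = (\<one>, a)" "a \<noteq> 0"
      using z powerful_exponent_p_series_trivial [OF p \<open>odd p\<close> ord pw exp] unfolding N_def
      by (cases z) simp
    then show ?thesis
      using twisted_product_central [OF \<alpha>' x] by blast
  qed
  have "((g, 1) \<otimes>\<^bsub>?E\<^esub> (h, 1)) [^]\<^bsub>?E\<^esub> (p ^ e)
      = (g, 1) [^]\<^bsub>?E\<^esub> (p ^ e) \<otimes>\<^bsub>?E\<^esub> (h, 1) [^]\<^bsub>?E\<^esub> (p ^ e)"
  proof (rule E.pow_mult_of_central [where e = e and i = 0])
    show "(g, 1) \<in> N 0" "(h, 1) \<in> N 0"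
      unfolding N_def using g h by simp_all
  qed (use \<open>odd p\<close> central in simp_all)
  also have "\<dots> = (\<one>, 1)"
    using cocycle_groupD(3) [OF \<alpha>'] g h exp by (simp add: unitary_section_pow [OF \<alpha>])
  finally show ?thesis
    using unitary_pow_of_mult [OF \<alpha> g h exp] g h by simp
qed

theorem powerful_exponent_unitary_cover:
  assumes p: "Factorial_Ring.prime p" and "p > 2" and pG: "finite_p_group p G" and pw: "powerful p G"
  shows "group_exponent (unitary_cover G) = group_exponent G"
proof -
  obtain k e where ord: "order G = p ^ k" and fin: "finite (carrier G)" and exp: "group_exponent G = p ^ e"
    by (rule finite_p_group_exponent [OF p pG])
  have pe: "g [^] (p ^ e) = \<one>" if "g \<in> carrier G" for g
    using group_exponent_pow(2) [OF fin that] exp by simp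
  have "odd p" using p \<open>p > 2\<close> by (simp add: prime_odd_nat)
  have R: "(\<forall>g \<in> carrier G. g [^] (p ^ e) = \<one>) \<and>
    (\<forall>\<alpha> \<in> unitary_cocycles G. \<forall>g \<in> carrier G. \<forall>h \<in> carrier G. \<alpha> (g, h) ^ (p ^ e) = 1)"
    using powerful_unitary_cocycle_pow [OF p \<open>odd p\<close> ord pw pe] pe by blast
  show ?thesis
  proof (rule group_exponent_eqI)
    show "0 < group_exponent G"
      by (rule group_exponent_pow(1) [OF fin])
    show "x [^]\<^bsub>unitary_cover G\<^esub> group_exponent G = \<one>\<^bsub>unitary_cover G\<^esub>"
      if "x \<in> carrier (unitary_cover G)" for x
      using R that unfolding unitary_cover_pow_eq_one_iff [symmetric] exp by blast
    show "group_exponent G \<le> m"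
      if "0 < m" "\<forall>x \<in> carrier (unitary_cover G). x [^]\<^bsub>unitary_cover G\<^esub> m = \<one>\<^bsub>unitary_cover G\<^esub>" for m
      using that unfolding unitary_cover_pow_eq_one_iff
      by (intro dvd_imp_le) (simp_all add: group_exponent_dvd_iff [OF fin])
  qed
qed

end

section \<open>Characters of abelian groups and bimultiplicative cocycles\<close>

lemma complex_root_exists:
  assumes "w \<noteq> 0" "n > 0"
  shows "\<exists>z :: complex. z ^ n = w"
proof -
  have "card {z. z ^ n = w} = n"
    using assms by (rule card_nth_roots)
  then show ?thesis
    using assms(2) by (metis (mono_tags) Collect_empty_eq card.empty less_numeral_extra(3))
qed

context comm_group
begin

text \<open>A character extends from \<open>H\<close> to the subgroup generated by \<open>H\<close> and \<open>x\<close>: if \<open>k\<close> is the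
  order of \<open>x\<close> modulo \<open>H\<close>, then \<open>x\<close> may be mapped to any \<open>k\<close>-th root of the value at \<open>x ^ k\<close>.\<close>

lemma character_extend_step:
  assumes fin: "finite (carrier G)" and H: "subgroup H G"
    and \<chi>0: "\<And>h. h \<in> H \<Longrightarrow> \<chi> h \<noteq> (0::complex)"
    and \<chi>: "\<And>h h'. h \<in> H \<Longrightarrow> h' \<in> H \<Longrightarrow> \<chi> (h \<otimes> h') = \<chi> h * \<chi> h'"
    and x: "x \<in> carrier G"
  obtains M \<psi> where "subgroup M G" "H \<subseteq> M" "x \<in> M" "\<And>h. h \<in> M \<Longrightarrow> \<psi> h \<noteq> (0::complex)"
    "\<And>h h'. h \<in> M \<Longrightarrow> h' \<in> M \<Longrightarrow> \<psi> (h \<otimes> h') = \<psi> h * \<psi> h'" "\<And>h. h \<in> H \<Longrightarrow> \<psi> h = \<chi> h"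
proof -
  interpret H: subgroup H G by (rule H)
  note [simp] = x
  define k :: nat where "k = (LEAST k. 0 < k \<and> x [^] k \<in> H)"
  have "0 < k \<and> x [^] k \<in> H"
    unfolding k_def
    by (rule LeastI [of _ "order G"]) (use fin in \<open>simp add: order_gt_0_iff_finite pow_order_eq_1\<close>)
  then have k: "0 < k" "x [^] k \<in> H" by auto
  have k_dvd: "k dvd d" if d: "x [^] d \<in> H" for d
  proof -
    have "x [^] d = (x [^] k) [^] (d div k) \<otimes> x [^] (d mod k)"
      by (simp add: nat_pow_pow nat_pow_mult)
    then have "x [^] (d mod k) = inv ((x [^] k) [^] (d div k)) \<otimes> x [^] d"
      by (simp add: inv_solve_left)
    also have "\<dots> \<in> H"
      using d k subgroup_nat_pow_closed [OF H] by simp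
    finally have "\<not> 0 < d mod k"
      using not_less_Least [of "d mod k" "\<lambda>k. 0 < k \<and> x [^] k \<in> H"] k
      unfolding k_def by (metis mod_less_divisor)
    then show ?thesis by (simp add: dvd_eq_mod_eq_0)
  qed
  obtain c where c: "c ^ k = \<chi> (x [^] k)"
    using complex_root_exists [OF \<chi>0 [OF k(2)] k(1)] by blast
  have \<chi>1: "\<chi> \<one> = 1"
    using \<chi> [of \<one> \<one>] \<chi>0 [of \<one>] by simp
  have \<chi>_pow: "\<chi> (h [^] q) = \<chi> h ^ q" if "h \<in> H" for h and q :: nat
    using that by (induction q) (simp_all add: \<chi>1 \<chi> subgroup_nat_pow_closed [OF H])
  have c0: "c \<noteq> 0"
    using c \<chi>0 [OF k(2)] k(1) by (metis zero_power)
  \<comment> \<open>Well-definedness of the extension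
    \<open>m \<otimes> x [^] i \<mapsto> \<chi> m * c ^ i\<close>: two representations of an element
    differ by a power of \<open>x\<close> in \<open>H\<close>, whose exponent is a multiple of
    \<open>k\<close>.\<close>
  have le: "\<chi> m * c ^ i = \<chi> m' * c ^ j"
    if m: "m \<in> H" "m' \<in> H" and eq: "m \<otimes> x [^] i = m' \<otimes> x [^] j" and "i \<le> j" for m m' i j
  proof -
    have "m \<otimes> x [^] i = (m' \<otimes> x [^] (j - i)) \<otimes> x [^] i"
      using m \<open>i \<le> j\<close> by (simp add: eq m_assoc nat_pow_mult)
    then have mm: "m = m' \<otimes> x [^] (j - i)"
      using m by simp
    then have "x [^] (j - i) = inv m' \<otimes> m"
      using m by (simp add: inv_solve_left)
    then have "x [^] (j - i) \<in> H"
      using m by simp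
    then obtain q where q: "j - i = k * q"
      using k_dvd by blast
    have "\<chi> m = \<chi> m' * c ^ (j - i)"
      using m k(2) by (simp add: mm q \<chi> \<chi>_pow c subgroup_nat_pow_closed [OF H] power_mult
          flip: nat_pow_pow)
    then show ?thesis
      using \<open>i \<le> j\<close> by (simp flip: power_add)
  qed
  have wd: "\<chi> m * c ^ i = \<chi> m' * c ^ j"
    if "m \<in> H" "m' \<in> H" "m \<otimes> x [^] i = m' \<otimes> x [^] j" for m m' i j
    using le [of m m' i j] le [of m' m j i] that by (cases "i \<le> j") auto
  define M where "M = {m \<otimes> x [^] (i::nat) |m i. m \<in> H}"
  define \<psi> where "\<psi> y = (SOME v. \<exists>m \<in> H. \<exists>i::nat. y = m \<otimes> x [^] i \<and> v = \<chi> m * c ^ i)" for y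
  have \<psi>_eq: "\<psi> (m \<otimes> x [^] i) = \<chi> m * c ^ i" if m: "m \<in> H" for m and i :: nat
  proof -
    have "\<exists>m' \<in> H. \<exists>j::nat. m \<otimes> x [^] i = m' \<otimes> x [^] j \<and> \<psi> (m \<otimes> x [^] i) = \<chi> m' * c ^ j"
      unfolding \<psi>_def by (rule someI_ex) (use m in blast)
    then show ?thesis
      using wd m by metis
  qed
  have MI: "m \<otimes> x [^] i \<in> M" if "m \<in> H" for m and i :: nat
    using that unfolding M_def by blast
  have mult: "(m \<otimes> x [^] i) \<otimes> (m' \<otimes> x [^] j) = (m \<otimes> m') \<otimes> x [^] (i + j)"
    if "m \<in> H" "m' \<in> H" for m m' and i j :: nat
    using that by (simp add: m_ac flip: nat_pow_mult)
  show thesis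
  proof
    show "subgroup M G"
    proof (rule subgroup.intro)
      fix y assume "y \<in> M"
      then obtain m and i :: nat where y: "y = m \<otimes> x [^] i" and m: "m \<in> H"
        by (auto simp: M_def)
      \<comment> \<open>The exponents in \<open>M\<close> are natural numbers, so the inverse of
        \<open>x ^ i\<close> is written as a positive power by means of the order of
        \<open>G\<close>.\<close>
      have "inv y = inv m \<otimes> x [^] ((order G - 1) * i)"
      proof (rule inv_equality)
        have "0 < order G" using fin by (simp add: order_gt_0_iff_finite)
        then have "i + (order G - 1) * i = order G * i"
          by (cases "order G") simp_all
        then show "inv m \<otimes> x [^] ((order G - 1) * i) \<otimes> y = \<one>"
          using m unfolding y by (subst mult) (simp_all add: add.commute pow_order_eq_1 flip: nat_pow_pow)
      qed (use m y in simp_all)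
      then show "inv y \<in> M"
        using MI m by simp
    next
      fix y z assume "y \<in> M" "z \<in> M"
      then obtain m m' and i j :: nat where "y = m \<otimes> x [^] i" "z = m' \<otimes> x [^] j" "m \<in> H" "m' \<in> H"
        by (auto simp: M_def)
      then show "y \<otimes> z \<in> M"
        using mult MI by simp
    next
      show "M \<subseteq> carrier G" by (auto simp: M_def)
      show "\<one> \<in> M" using MI [of \<one> 0] by simp
    qed
    show "H \<subseteq> M" using MI [of _ 0] by auto
    show "x \<in> M" using MI [of \<one> 1] by simp
    show "\<psi> h \<noteq> 0" if "h \<in> M" for h
      using that \<chi>0 c0 by (auto simp: M_def \<psi>_eq)
    show "\<psi> (h \<otimes> h') = \<psi> h * \<psi> h'" if "h \<in> M" "h' \<in> M" for h h'
    proof -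
      obtain m m' and i j :: nat where "h = m \<otimes> x [^] i" "h' = m' \<otimes> x [^] j" "m \<in> H" "m' \<in> H"
        using \<open>h \<in> M\<close> \<open>h' \<in> M\<close> by (auto simp: M_def)
      then show ?thesis
        by (simp add: mult \<psi>_eq \<chi> power_add)
    qed
    show "\<psi> h = \<chi> h" if "h \<in> H" for h
      using \<psi>_eq [of h 0] that by simp
  qed
qed

text \<open>The extension by one element is repeated; the complement of the subgroup is finite and
  shrinks each time.\<close>

lemma character_extend:
  assumes fin: "finite (carrier G)" and "subgroup H G"
    and "\<And>h. h \<in> H \<Longrightarrow> \<chi> h \<noteq> (0::complex)"
    and "\<And>h h'. h \<in> H \<Longrightarrow> h' \<in> H \<Longrightarrow> \<chi> (h \<otimes> h') = \<chi> h * \<chi> h'"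
  shows "\<exists>\<psi>. (\<forall>g \<in> carrier G. \<psi> g \<noteq> 0) \<and>
    (\<forall>g \<in> carrier G. \<forall>g' \<in> carrier G. \<psi> (g \<otimes> g') = \<psi> g * \<psi> g') \<and> (\<forall>h \<in> H. \<psi> h = \<chi> h)"
  using assms(2-)
proof (induction "card (carrier G - H)" arbitrary: H \<chi> rule: less_induct)
  case less
  show ?case
  proof (cases "H = carrier G")
    case True
    then show ?thesis using less.prems by blast
  next
    case False
    then obtain x where x: "x \<in> carrier G" "x \<notin> H"
      using subgroup.subset [OF less.prems(1)] by blast
    obtain M \<psi> where M: "subgroup M G" "H \<subseteq> M" "x \<in> M" "\<And>h. h \<in> M \<Longrightarrow> \<psi> h \<noteq> 0"
      "\<And>h h'. h \<in> M \<Longrightarrow> h' \<in> M \<Longrightarrow> \<psi> (h \<otimes> h') = \<psi> h * \<psi> h'"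
      and eq: "\<And>h. h \<in> H \<Longrightarrow> \<psi> h = \<chi> h"
      using character_extend_step [OF fin less.prems x(1)] by metis
    have "carrier G - M \<subset> carrier G - H"
      using M x by blast
    then have "card (carrier G - M) < card (carrier G - H)"
      using fin by (intro psubset_card_mono) simp_all
    from less.hyps [OF this M(1,4,5)] obtain \<theta> where
      "\<forall>g \<in> carrier G. \<theta> g \<noteq> 0" "\<forall>g \<in> carrier G. \<forall>g' \<in> carrier G. \<theta> (g \<otimes> g') = \<theta> g * \<theta> g'"
      and \<theta>: "\<forall>h \<in> M. \<theta> h = \<psi> h"
      by blast
    moreover have "\<forall>h \<in> H. \<theta> h = \<chi> h"
      using \<theta> eq M(2) by auto
    ultimately show ?thesis by blast
  qed
qed

end

context group
begin

text \<open>A bimultiplicative function is a cocycle; multiplying it by the coboundary of a function \<open>u\<close>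
  with \<open>u x ^ ord x * (\<Prod>j<ord x. f x (x ^ j)) = 1\<close> makes it unitary.\<close>

lemma unitary_cocycle_of_bimultiplicative:
  assumes fin: "finite (carrier G)"
    and f0: "\<And>x y. x \<in> carrier G \<Longrightarrow> y \<in> carrier G \<Longrightarrow> f x y \<noteq> (0::complex)"
    and fl: "\<And>x y z. x \<in> carrier G \<Longrightarrow> y \<in> carrier G \<Longrightarrow> z \<in> carrier G \<Longrightarrow>
      f (x \<otimes> y) z = f x z * f y z"
    and fr: "\<And>x y z. x \<in> carrier G \<Longrightarrow> y \<in> carrier G \<Longrightarrow> z \<in> carrier G \<Longrightarrow>
      f x (y \<otimes> z) = f x y * f x z"
  obtains \<alpha> where "\<alpha> \<in> unitary_cocycles G"
    "\<And>x y. x \<in> carrier G \<Longrightarrow> y \<in> carrier G \<Longrightarrow> x \<otimes> y = y \<otimes> x \<Longrightarrow>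
      \<alpha> (x, y) / \<alpha> (y, x) = f x y / f y x"
proof -
  have "\<exists>v. v ^ ord x = inverse (\<Prod>j<group.ord G x. f x (x [^] j))" if "x \<in> carrier G" for x
    using that f0 ord_ge_1 [OF fin that] by (intro complex_root_exists) auto
  then obtain u where u: "\<And>x. x \<in> carrier G \<Longrightarrow> u x ^ ord x = inverse (\<Prod>j<group.ord G x. f x (x [^] j))"
    by metis
  have u0: "u x \<noteq> 0" if x: "x \<in> carrier G" for x
  proof
    assume "u x = 0"
    then have "inverse (\<Prod>j<group.ord G x. f x (x [^] j)) = 0"
      using u [OF x] ord_ge_1 [OF fin x] by (simp add: zero_power)
    then show False using f0 x by simp
  qed
  have f1: "f \<one> \<one> = 1"
    using fl [of \<one> \<one> \<one>] f0 [of \<one> \<one>] by simp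
  have u1: "u \<one> = 1"
    using u [of \<one>] f1 by simp
  define \<alpha> where "\<alpha> = (\<lambda>(x, y) \<in> carrier G \<times> carrier G. f x y * (u x * u y / u (x \<otimes> y)))"
  have \<alpha>: "\<alpha> (x, y) = f x y * (u x * u y / u (x \<otimes> y))" if "x \<in> carrier G" "y \<in> carrier G" for x y
    using that by (simp add: \<alpha>_def)
  show thesis
  proof
    have coc: "\<alpha> \<in> carrier (cocycle_group G)"
    proof -
      have "\<alpha> (x, y) * \<alpha> (x \<otimes> y, z) = \<alpha> (x, y \<otimes> z) * \<alpha> (y, z)"
        if [simp]: "x \<in> carrier G" "y \<in> carrier G" "z \<in> carrier G" for x y z
        using u0 [of "x \<otimes> y"] u0 [of "y \<otimes> z"] by (simp add: \<alpha> fl fr m_assoc)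
      moreover have "\<alpha> \<in> carrier G \<times> carrier G \<rightarrow>\<^sub>E carrier complex_units"
        using f0 u0 by (auto simp: \<alpha>_def complex_units_def)
      ultimately show ?thesis
        by (simp add: cocycle_group_def \<alpha> f1 u1)
    qed
    have "(\<Prod>j<group.ord G x. \<alpha> (x, x [^] j)) = 1" if x: "x \<in> carrier G" for x
    proof -
      \<comment> \<open>The values of the coboundary along the powers of \<open>x\<close> telescope.
        For \<open>m = ord x\<close> only \<open>u x ^ ord x\<close> is left, which was chosen to
        cancel the product of the values of \<open>f\<close>.\<close>
      have tel: "(\<Prod>j<m. u x * u (x [^] j) / u (x \<otimes> x [^] j)) = u x ^ m / u (x [^] m)" for m :: nat
      proof (induction m)
        case (Suc m)
        then show ?case
          using u0 [of "x [^] m"] nat_pow_Suc2 [OF x, of m] x by (simp add: field_simps)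
      qed (simp add: u1)
      have "(\<Prod>j<group.ord G x. \<alpha> (x, x [^] j))
          = (\<Prod>j<group.ord G x. f x (x [^] j)) * (u x ^ ord x / u (x [^] ord x))"
        unfolding tel [symmetric] prod.distrib [symmetric] using x by (intro prod.cong) (simp_all add: \<alpha>)
      also have "\<dots> = 1"
        using x f0 by (simp add: u u1)
      finally show ?thesis .
    qed
    then show "\<alpha> \<in> unitary_cocycles G"
      using coc by (simp add: unitary_cocycles_def)
    \<comment> \<open>The coboundary is symmetric on commuting pairs and cancels in the
      quotient.\<close>
    show "\<alpha> (x, y) / \<alpha> (y, x) = f x y / f y x"
      if "x \<in> carrier G" "y \<in> carrier G" "x \<otimes> y = y \<otimes> x" for x y
      using that u0 [of x] u0 [of y] u0 [of "y \<otimes> x"] by (simp add: \<alpha> mult.commute)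
  qed
qed

end

section \<open>Abelian 2-groups\<close>

lemma complex_root_of_unity_power:
  assumes "n > 0" "w ^ n = (1::complex)"
  shows "\<exists>k. w = cis (2 * pi / real n) ^ k"
proof -
  have "w \<in> (\<lambda>k. cis (2 * pi * real k / real n)) ` {..<n}"
    using bij_betw_roots_unity [OF assms(1)] assms(2) by (simp add: bij_betw_def)
  then show ?thesis
    by (auto simp: DeMoivre mult_ac)
qed

text \<open>For positive \<open>n\<close> this turns an \<open>n\<close>-th root of unity into a
  character of \<open>integer_mod_group n\<close>, whose elements are integers added modulo
  \<open>n\<close>.\<close>

lemma power_nat_mod:
  assumes "z ^ n = (1::complex)" "0 \<le> a" "0 \<le> b"
  shows "z ^ nat ((a + b) mod int n) = z ^ nat a * z ^ nat b"
proof -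
  have mod: "z ^ (k mod n) = z ^ k" for k
  proof -
    have "z ^ k = z ^ (n * (k div n) + k mod n)" by simp
    also have "\<dots> = z ^ (k mod n)"
      unfolding power_add power_mult by (simp add: assms(1))
    finally show ?thesis by simp
  qed
  have "nat ((a + b) mod int n) = (nat a + nat b) mod n"
    using assms by (simp add: nat_mod_distrib nat_add_distrib)
  then show ?thesis by (simp add: mod power_add)
qed

context comm_group
begin

text \<open>In the extension \<open>(h, 1)\<close> and \<open>(g, 1)\<close> commute up to the
  central element given by the quotient on the right. In the class two formula their own
  \<open>n\<close>-th powers are trivial, and only the power of the quotient remains.\<close>

lemma unitary_cocycle_pow:
  assumes \<alpha>: "\<alpha> \<in> unitary_cocycles G" and g: "g \<in> carrier G" and h: "h \<in> carrier G"
    and gn: "g [^] (n::nat) = \<one>" and hn: "h [^] n = \<one>"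
  shows "\<alpha> (g, h) ^ n = (\<alpha> (h, g) / \<alpha> (g, h)) ^ (n * (n - 1) div 2)"
proof -
  note \<alpha>' = unitary_cocyclesD(1) [OF \<alpha>]
  interpret E: group "twisted_product G \<alpha>" by (rule twisted_product_group [OF \<alpha>'])
  let ?c = "\<alpha> (h, g) / \<alpha> (g, h)"
  have c: "?c \<noteq> 0" using cocycle_groupD(1) [OF \<alpha>'] g h by simp
  have "(\<one>, \<alpha> (g, h) ^ n)
      = ((g, 1) \<otimes>\<^bsub>twisted_product G \<alpha>\<^esub> (h, 1)) [^]\<^bsub>twisted_product G \<alpha>\<^esub> n"
    using pow_mult_distrib [of g h n] m_comm g h gn hn
    by (intro unitary_pow_of_mult [OF \<alpha> g h, symmetric]) simp
  also have "\<dots> = (\<one>, ?c) [^]\<^bsub>twisted_product G \<alpha>\<^esub> (n * (n - 1) div 2)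
      \<otimes>\<^bsub>twisted_product G \<alpha>\<^esub> (g, 1) [^]\<^bsub>twisted_product G \<alpha>\<^esub> n
      \<otimes>\<^bsub>twisted_product G \<alpha>\<^esub> (h, 1) [^]\<^bsub>twisted_product G \<alpha>\<^esub> n"
  proof (rule E.pow_mult_class_two)
    show "(h, 1) \<otimes>\<^bsub>twisted_product G \<alpha>\<^esub> (g, 1)
        = (\<one>, ?c) \<otimes>\<^bsub>twisted_product G \<alpha>\<^esub> (g, 1) \<otimes>\<^bsub>twisted_product G \<alpha>\<^esub> (h, 1)"
      using cocycle_groupD(1) [OF \<alpha>' g h] g h by (simp add: cocycle_one [OF \<alpha>'] m_comm)
  qed (use g h c in \<open>simp_all add: cocycle_one [OF \<alpha>']\<close>)
  also have "\<dots> = (\<one>, ?c ^ (n * (n - 1) div 2))"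
    using c cocycle_groupD(3) [OF \<alpha>']
    by (simp add: unitary_section_pow [OF \<alpha> g gn] unitary_section_pow [OF \<alpha> h hn]
        twisted_product_pow [OF \<alpha>'] del: power_divide)
  finally show ?thesis by simp
qed

text \<open>Moving \<open>(h, 1) ^ m\<close> past \<open>(g, 1)\<close> costs the
  \<open>m\<close>-th power of the quotient. But the two commute, since \<open>(h, 1) ^ m\<close>
  lies in the central kernel or differs from \<open>(g, 1) ^ m\<close> by an element of it.\<close>

lemma cocycle_commutator_pow:
  assumes \<alpha>: "\<alpha> \<in> carrier (cocycle_group G)" and g: "g \<in> carrier G" and h: "h \<in> carrier G"
    and hm: "h [^] (m::nat) = \<one> \<or> h [^] m = g [^] m"
  shows "(\<alpha> (h, g) / \<alpha> (g, h)) ^ m = 1"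
proof -
  let ?E = "twisted_product G \<alpha>"
  interpret E: group ?E by (rule twisted_product_group [OF \<alpha>])
  let ?c = "\<alpha> (h, g) / \<alpha> (g, h)"
  have c: "?c \<noteq> 0" using cocycle_groupD(1) [OF \<alpha>] g h by simp
  obtain a where hm_eq: "(h, 1) [^]\<^bsub>?E\<^esub> m = (h [^] m, a)" and a: "a \<noteq> 0"
    using twisted_product_pow [OF \<alpha> h, of 1 m] cocycle_groupD(1) [OF \<alpha>] h by simp
  obtain b where gm_eq: "(g, 1) [^]\<^bsub>?E\<^esub> m = (g [^] m, b)" and b: "b \<noteq> 0"
    using twisted_product_pow [OF \<alpha> g, of 1 m] cocycle_groupD(1) [OF \<alpha>] g by simp
  have comm: "(h, 1) [^]\<^bsub>?E\<^esub> m \<otimes>\<^bsub>?E\<^esub> (g, 1) = (g, 1) \<otimes>\<^bsub>?E\<^esub> (h, 1) [^]\<^bsub>?E\<^esub> m"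
    using hm
  proof
    assume "h [^] m = \<one>"
    then show ?thesis
      using twisted_product_central [OF \<alpha>, of "(g, 1)" a] g a by (simp add: hm_eq)
  next
    assume eq: "h [^] m = g [^] m"
    have "(g, 1) [^]\<^bsub>?E\<^esub> m \<otimes>\<^bsub>?E\<^esub> (g, 1) = (g, 1) \<otimes>\<^bsub>?E\<^esub> (g, 1) [^]\<^bsub>?E\<^esub> m"
      using g by (intro E.pow_commute) simp_all
    then show ?thesis
      using b by (simp add: hm_eq gm_eq eq)
  qed
  have "(h, 1) [^]\<^bsub>?E\<^esub> m \<otimes>\<^bsub>?E\<^esub> (g, 1)
      = (\<one>, ?c) [^]\<^bsub>?E\<^esub> m \<otimes>\<^bsub>?E\<^esub> (g, 1) \<otimes>\<^bsub>?E\<^esub> (h, 1) [^]\<^bsub>?E\<^esub> m"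
  proof (rule E.pow_mult_commute_central)
    show "(h, 1) \<otimes>\<^bsub>?E\<^esub> (g, 1) = (\<one>, ?c) \<otimes>\<^bsub>?E\<^esub> (g, 1) \<otimes>\<^bsub>?E\<^esub> (h, 1)"
      using cocycle_groupD(1) [OF \<alpha> g h] g h by (simp add: cocycle_one [OF \<alpha>] m_comm)
  qed (use g h c in \<open>simp_all add: cocycle_one [OF \<alpha>]\<close>)
  moreover have "(\<one>, ?c) [^]\<^bsub>?E\<^esub> m = (\<one>, ?c ^ m)"
    using twisted_product_pow [OF \<alpha> one_closed c, of m] cocycle_groupD(3) [OF \<alpha>]
    by (simp del: power_divide)
  ultimately show ?thesis
    using comm a g h cocycle_groupD(1) [OF \<alpha>, of g "h [^] m"]
    by (simp add: hm_eq cocycle_one [OF \<alpha>] del: power_divide)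
qed

section \<open>Independent involutions and homocyclic subgroups\<close>

lemma involutions_int_pow:
  assumes A: "A \<in> carrier G" "A [^] (2::nat) = \<one>" "A \<noteq> \<one>"
    and B: "B \<in> carrier G" "B [^] (2::nat) = \<one>" "B \<noteq> \<one>"
    and "A \<noteq> B" and eq: "A [^] (i::int) \<otimes> B [^] (j::int) = \<one>"
  shows "even i \<and> even j"
proof -
  have pow: "x [^] i = (if even i then \<one> else x)"
    if x: "x \<in> carrier G" "x [^] (2::nat) = \<one>" for x and i :: int
  proof -
    have x2: "x [^] (2::int) = \<one>"
      using x int_pow_int [of G x 2] by simp
    have "x [^] (2 * (i div 2)) = \<one>"
      using x x2 int_pow_pow [of x 2 "i div 2"] by simp
    moreover have "x [^] i = x [^] (2 * (i div 2)) \<otimes> x [^] (i mod 2)"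
      using x by (simp flip: int_pow_mult)
    ultimately have "x [^] i = x [^] (i mod 2)"
      using x(1) by (metis int_pow_closed l_one)
    moreover have "x [^] (i mod 2) = (if even i then \<one> else x)"
      using x(1) by (auto simp: odd_iff_mod_2_eq_one)
    ultimately show ?thesis by (rule trans)
  qed
  have "A = B" if "A \<otimes> B = \<one>"
  proof -
    have "A \<otimes> B = B \<otimes> B" using that B by (simp add: numeral_2_eq_2)
    then show ?thesis using A B by simp
  qed
  then show ?thesis
    using eq pow [OF A(1,2)] pow [OF B(1,2)] assms by (auto split: if_splits)
qed

text \<open>The map \<open>(i, j) \<mapsto> g ^ i h ^ j\<close> is injective: in a relation both
  exponents are divisible by \<open>2 ^ k\<close> for every \<open>k\<close> up to
  \<open>e + 1\<close>, hence by \<open>n\<close>.\<close>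

lemma homocyclic_subgroup:
  assumes g: "g \<in> carrier G" "g [^] (2 ^ Suc e :: nat) = \<one>" "g [^] (2 ^ e :: nat) \<noteq> \<one>"
    and h: "h \<in> carrier G" "h [^] (2 ^ Suc e :: nat) = \<one>" "h [^] (2 ^ e :: nat) \<noteq> \<one>"
    and gh: "g [^] (2 ^ e :: nat) \<noteq> h [^] (2 ^ e :: nat)"
  defines "n \<equiv> 2 ^ Suc e"
  shows "\<exists>K. subgroup K G \<and> G\<lparr>carrier := K\<rparr> \<cong> integer_mod_group n \<times>\<times> integer_mod_group n"
proof -
  let ?Z = "integer_mod_group n \<times>\<times> integer_mod_group n"
  define \<phi> where "\<phi> = (\<lambda>(i, j). g [^] (i::int) \<otimes> h [^] (j::int))"
  have pow_mod: "x [^] (i mod int n) = x [^] i" if x: "x \<in> carrier G" "x [^] n = \<one>" for x and i :: int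
  proof -
    have "x [^] (int n * (i div int n)) = \<one>"
      using x int_pow_int [of G x n] int_pow_pow [of x "int n" "i div int n"] by simp
    moreover have "x [^] i = x [^] (int n * (i div int n)) \<otimes> x [^] (i mod int n)"
      using x by (simp flip: int_pow_mult)
    ultimately show ?thesis using x(1) by (metis int_pow_closed l_one)
  qed
  interpret Z: group ?Z
    by (intro DirProd_group group_integer_mod_group)
  interpret \<phi>: group_hom ?Z G \<phi>
  proof (intro group_hom.intro group_hom_axioms.intro Z.is_group is_group homI)
    fix x y
    show "\<phi> (x \<otimes>\<^bsub>?Z\<^esub> y) = \<phi> x \<otimes> \<phi> y"
      using g h by (cases x; cases y) (simp add: \<phi>_def pow_mod n_def[symmetric] int_pow_mult m_ac
          del: power_Suc)
  qed (use g h in \<open>auto simp: \<phi>_def\<close>)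
  have inj: "inj_on \<phi> (carrier ?Z)"
  proof (subst \<phi>.inj_iff_trivial_ker, rule antisym)
    show "kernel ?Z G \<phi> \<subseteq> {\<one>\<^bsub>?Z\<^esub>}"
    proof
      fix x assume x: "x \<in> kernel ?Z G \<phi>"
      obtain i j where ij: "x = (i, j)" by (cases x)
      have one: "g [^] i \<otimes> h [^] j = \<one>"
        using x by (simp add: kernel_def ij \<phi>_def)
      have dvd: "2 ^ k dvd i \<and> 2 ^ k dvd j" if "k \<le> Suc e" for k
        using that
      proof (induction k)
        case (Suc k)
        then obtain i' j' where i': "i = 2 ^ k * i'" and j': "j = 2 ^ k * j'"
          by (auto elim!: dvdE)
        have "(2::int) ^ k * 2 ^ (e - k) = 2 ^ e"
          using Suc.prems by (simp flip: power_add)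
        then have exps: "i * 2 ^ (e - k) = 2 ^ e * i'" "j * 2 ^ (e - k) = 2 ^ e * j'"
          by (simp_all add: i' j' mult_ac)
        have conv: "x [^] (2 ^ e * l :: int) = (x [^] (2 ^ e :: nat)) [^] l" if "x \<in> carrier G" for x l
          using that int_pow_pow [of x "2 ^ e" l] int_pow_int [of G x "2 ^ e"] by simp
        \<comment> \<open>This power turns the relation into one between the two involutions with
          exponents \<open>i'\<close> and \<open>j'\<close>. Their independence makes these even,
          which gains a further factor 2.\<close>
        have "(g [^] i \<otimes> h [^] j) [^] (2 ^ (e - k) :: int) = \<one>"
          by (simp add: one)
        then have "(g [^] (2 ^ e :: nat)) [^] i' \<otimes> (h [^] (2 ^ e :: nat)) [^] j' = \<one>"
          using g h by (simp add: int_pow_distrib int_pow_pow exps conv)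
        then have "even i' \<and> even j'"
          using g h gh by (intro involutions_int_pow) (simp_all add: nat_pow_pow mult.commute)
        then show ?case
          by (auto simp: i' j')
      qed simp
      have "0 \<le> i" "i < int n" "0 \<le> j" "j < int n"
        using x by (auto simp: kernel_def ij carrier_integer_mod_group n_def)
      then have "i = 0" "j = 0"
        using dvd [of "Suc e"] zdvd_not_zless [of i "2 ^ Suc e"] zdvd_not_zless [of j "2 ^ Suc e"]
        unfolding n_def by force+
      then show "x \<in> {\<one>\<^bsub>?Z\<^esub>}" by (simp add: ij)
    qed
    show "{\<one>\<^bsub>?Z\<^esub>} \<subseteq> kernel ?Z G \<phi>"
      by (simp add: kernel_def \<phi>_def)
  qed
  have "\<phi> \<in> iso ?Z (G\<lparr>carrier := \<phi> ` carrier ?Z\<rparr>)"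
    unfolding iso_def hom_def bij_betw_def
    using inj \<phi>.hom_mult by (simp del: carrier_DirProd mult_DirProd')
  then have "G\<lparr>carrier := \<phi> ` carrier ?Z\<rparr> \<cong> ?Z"
    using Z.iso_sym is_isoI by blast
  moreover have "subgroup (\<phi> ` carrier ?Z) G"
    by (rule \<phi>.img_is_subgroup)
  ultimately show ?thesis by blast
qed

end

section \<open>The exponent of the cover of an abelian 2-group\<close>

context comm_group
begin

text \<open>The cocycle comes from \<open>lam x ^ b y\<close>, where \<open>lam\<close> and
  \<open>mu = \<zeta> ^ b\<close> extend the coordinate characters of \<open>K\<close>. On the
  standard generators its commutator quotient is the inverse of \<zeta>; raised to
  \<open>n / 2 * (n - 1)\<close> it gives -1, as \<open>n - 1\<close> is odd.\<close>

lemma homocyclic_unitary_cocycle: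
  assumes fin: "finite (carrier G)" and n: "n = 2 ^ Suc e"
    and exp: "\<And>x. x \<in> carrier G \<Longrightarrow> x [^] n = \<one>"
    and K: "subgroup K G" and iso: "G\<lparr>carrier := K\<rparr> \<cong> integer_mod_group n \<times>\<times> integer_mod_group n"
  shows "\<exists>\<alpha> \<in> unitary_cocycles G. \<exists>g \<in> carrier G. \<exists>h \<in> carrier G. \<alpha> (g, h) ^ n \<noteq> 1"
proof -
  interpret K: subgroup K G by (rule K)
  let ?Z = "integer_mod_group n \<times>\<times> integer_mod_group n"
  have "n > 1" unfolding n by (rule one_less_power) simp_all
  define \<zeta> where "\<zeta> = cis (2 * pi / real n)"
  have \<zeta>n: "\<zeta> ^ n = 1"
    using \<open>n > 1\<close> by (simp add: \<zeta>_def DeMoivre)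
  have \<zeta>2: "\<zeta> ^ (2 ^ e) = -1"
    using n by (simp add: \<zeta>_def DeMoivre)
  have \<zeta>0: "\<zeta> \<noteq> 0" by (simp add: \<zeta>_def)
  obtain \<phi> where \<phi>: "\<phi> \<in> iso (G\<lparr>carrier := K\<rparr>) ?Z"
    using iso by (auto simp: is_iso_def)
  have \<phi>_bij: "bij_betw \<phi> K (carrier ?Z)"
    using \<phi> by (simp add: iso_def)
  have \<phi>_mem: "0 \<le> fst (\<phi> x) \<and> 0 \<le> snd (\<phi> x)" if "x \<in> K" for x
    using bij_betwE [OF \<phi>_bij] that \<open>n > 1\<close> by (force simp: carrier_integer_mod_group)
  have \<phi>_mult: "\<phi> (x \<otimes> y) = ((fst (\<phi> x) + fst (\<phi> y)) mod int n, (snd (\<phi> x) + snd (\<phi> y)) mod int n)"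
    if "x \<in> K" "y \<in> K" for x y
    using \<phi> that by (simp add: iso_def hom_def mult_DirProd' split_beta)
  have mult1: "\<zeta> ^ nat (fst (\<phi> (x \<otimes> y))) = \<zeta> ^ nat (fst (\<phi> x)) * \<zeta> ^ nat (fst (\<phi> y))"
    and mult2: "\<zeta> ^ nat (snd (\<phi> (x \<otimes> y))) = \<zeta> ^ nat (snd (\<phi> x)) * \<zeta> ^ nat (snd (\<phi> y))"
    if "x \<in> K" "y \<in> K" for x y
    using \<phi>_mem that by (simp_all add: \<phi>_mult power_nat_mod [OF \<zeta>n])
  obtain lam where lam0: "\<forall>x \<in> carrier G. lam x \<noteq> 0"
    and lam_mult: "\<forall>x \<in> carrier G. \<forall>y \<in> carrier G. lam (x \<otimes> y) = lam x * lam y"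
    and lam_K: "\<forall>x \<in> K. lam x = \<zeta> ^ nat (fst (\<phi> x))"
    using character_extend [OF fin K, of "\<lambda>x. \<zeta> ^ nat (fst (\<phi> x))"] \<zeta>0 mult1 by auto
  obtain mu where mu0: "\<forall>x \<in> carrier G. mu x \<noteq> 0"
    and mu_mult: "\<forall>x \<in> carrier G. \<forall>y \<in> carrier G. mu (x \<otimes> y) = mu x * mu y"
    and mu_K: "\<forall>x \<in> K. mu x = \<zeta> ^ nat (snd (\<phi> x))"
    using character_extend [OF fin K, of "\<lambda>x. \<zeta> ^ nat (snd (\<phi> x))"] \<zeta>0 mult2 by auto
  have root: "\<exists>k. \<psi> x = \<zeta> ^ k"
    if \<psi>0: "\<forall>x \<in> carrier G. \<psi> x \<noteq> 0"
      and \<psi>: "\<forall>x \<in> carrier G. \<forall>y \<in> carrier G. \<psi> (x \<otimes> y) = \<psi> x * \<psi> y" and x: "x \<in> carrier G" for \<psi> x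
  proof -
    have "\<psi> \<one> * \<psi> \<one> = \<psi> \<one>"
      using bspec [OF bspec [OF \<psi> one_closed] one_closed] by simp
    then have \<psi>1: "\<psi> \<one> = 1"
      using \<psi>0 by simp
    have "\<psi> (x [^] k) = \<psi> x ^ k" for k :: nat
      by (induction k) (use \<psi>1 \<psi> x in simp_all)
    then have "\<psi> x ^ n = 1"
      using exp [OF x] \<psi>1 by metis
    then show ?thesis
      unfolding \<zeta>_def using \<open>n > 1\<close> by (intro complex_root_of_unity_power) simp_all
  qed
  obtain b where b: "\<And>x. x \<in> carrier G \<Longrightarrow> mu x = \<zeta> ^ b x"
    using root [OF mu0 mu_mult] by metis
  \<comment> \<open>The logarithm \<open>b\<close> is an arbitrary choice and additive only modulo
    \<open>n\<close>. Since \<open>lam x\<close> is a power of \<zeta> as well,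
    \<open>lam x ^ b y\<close> is still multiplicative in \<open>y\<close>.\<close>
  have lam_eq: "lam x ^ i = lam x ^ j" if x: "x \<in> carrier G" and eq: "\<zeta> ^ i = \<zeta> ^ j" for x i j
  proof -
    obtain l where "lam x = \<zeta> ^ l"
      using root [OF lam0 lam_mult x] by blast
    then show ?thesis
      using eq by (metis power_mult mult.commute)
  qed
  obtain \<alpha> where \<alpha>: "\<alpha> \<in> unitary_cocycles G"
    and \<alpha>_comm: "\<And>x y. x \<in> carrier G \<Longrightarrow> y \<in> carrier G \<Longrightarrow> x \<otimes> y = y \<otimes> x \<Longrightarrow>
      \<alpha> (x, y) / \<alpha> (y, x) = lam x ^ b y / lam y ^ b x"
  proof (rule unitary_cocycle_of_bimultiplicative [OF fin, of "\<lambda>x y. lam x ^ b y"])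
    fix x y z assume xyz: "x \<in> carrier G" "y \<in> carrier G" "z \<in> carrier G"
    have "\<zeta> ^ b (y \<otimes> z) = \<zeta> ^ (b y + b z)"
      using b [of y] b [of z] b [of "y \<otimes> z"] mu_mult xyz by (simp add: power_add)
    from lam_eq [OF xyz(1) this] show "lam x ^ b (y \<otimes> z) = lam x ^ b y * lam x ^ b z"
      by (simp add: power_add)
  qed (use lam0 lam_mult in \<open>auto simp: power_mult_distrib\<close>)
  have "(1, 0) \<in> \<phi> ` K" "(0, 1) \<in> \<phi> ` K"
    using \<phi>_bij \<open>n > 1\<close> by (auto simp: bij_betw_def carrier_integer_mod_group)
  then obtain g h where g: "g \<in> K" "\<phi> g = (1, 0)" and h: "h \<in> K" "\<phi> h = (0, 1)"
    by (metis imageE)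
  have gG: "g \<in> carrier G" and hG: "h \<in> carrier G" using g h by simp_all
  have "lam h = 1" using lam_K h by simp
  moreover have "lam g ^ b h = \<zeta>"
    using lam_K g mu_K h b [OF hG] by simp
  ultimately have c: "\<alpha> (h, g) / \<alpha> (g, h) = inverse \<zeta>"
    using \<alpha>_comm [OF hG gG m_comm [OF hG gG]] by (simp add: divide_inverse)
  have "n * (n - 1) div 2 = 2 ^ e * (n - 1)"
    using n by simp
  then have "\<alpha> (g, h) ^ n = inverse (\<zeta> ^ (2 ^ e)) ^ (n - 1)"
    using unitary_cocycle_pow [OF \<alpha> gG hG exp [OF gG] exp [OF hG]]
    by (simp add: c power_mult power_inverse)
  also have "\<dots> = -1"
    using n \<open>n > 1\<close> by (simp add: \<zeta>2)
  finally show ?thesis using \<alpha> gG hG by force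
qed

text \<open>By \<open>homocyclic_subgroup\<close> the \<open>n / 2\<close>-th powers of
  \<open>g\<close> and \<open>h\<close> are equal or one of them is trivial. In each case
  \<open>cocycle_commutator_pow\<close> with \<open>m = n / 2\<close> kills the commutator
  quotient.\<close>

lemma no_homocyclic_unitary_cocycle_pow:
  assumes n: "n = 2 ^ Suc e" and exp: "\<And>x. x \<in> carrier G \<Longrightarrow> x [^] n = \<one>"
    and no: "\<nexists>K. subgroup K G \<and> G\<lparr>carrier := K\<rparr> \<cong> integer_mod_group n \<times>\<times> integer_mod_group n"
    and \<alpha>: "\<alpha> \<in> unitary_cocycles G" and g: "g \<in> carrier G" and h: "h \<in> carrier G"
  shows "\<alpha> (g, h) ^ n = 1"
proof -
  note \<alpha>' = unitary_cocyclesD(1) [OF \<alpha>]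
  let ?c = "\<alpha> (h, g) / \<alpha> (g, h)"
  consider "h [^] (2 ^ e :: nat) = \<one> \<or> h [^] (2 ^ e :: nat) = g [^] (2 ^ e :: nat)"
    | "g [^] (2 ^ e :: nat) = \<one>"
    using homocyclic_subgroup [of g e h] exp g h no unfolding n by metis
  then have "?c ^ (2 ^ e) = 1"
  proof cases
    case 1
    then show ?thesis by (rule cocycle_commutator_pow [OF \<alpha>' g h])
  next
    case 2
    \<comment> \<open>Interchanging \<open>g\<close> and \<open>h\<close> inverts the
      quotient.\<close>
    then have "inverse ?c ^ (2 ^ e) = 1"
      using cocycle_commutator_pow [OF \<alpha>' h g, of "2 ^ e"] by simp
    then show ?thesis
      by (metis inverse_1 inverse_inverse_eq power_inverse)
  qed
  moreover have "n * (n - 1) div 2 = 2 ^ e * (n - 1)"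
    using n by simp
  ultimately show ?thesis
    using unitary_cocycle_pow [OF \<alpha> g h exp [OF g] exp [OF h]]
    by (simp add: power_mult del: power_divide)
qed

text \<open>Doubling clears the denominator in \<open>n (n - 1) / 2\<close>, and the
  \<open>n\<close>-th power of the commutator quotient is trivial.\<close>

lemma unitary_cocycle_pow_double:
  assumes \<alpha>: "\<alpha> \<in> unitary_cocycles G" and g: "g \<in> carrier G" and h: "h \<in> carrier G"
    and gn: "g [^] (n::nat) = \<one>" and hn: "h [^] n = \<one>"
  shows "\<alpha> (g, h) ^ (2 * n) = 1"
proof -
  let ?c = "\<alpha> (h, g) / \<alpha> (g, h)"
  have "\<alpha> (g, h) ^ (2 * n) = (\<alpha> (g, h) ^ n) ^ 2"
    by (simp add: mult.commute power_mult)
  also have "\<dots> = ?c ^ (n * (n - 1) div 2 * 2)"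
    by (simp only: unitary_cocycle_pow [OF assms] power_mult)
  also have "n * (n - 1) div 2 * 2 = n * (n - 1)"
    by (intro dvd_div_mult_self) (cases "even n"; simp)
  also have "?c ^ \<dots> = 1"
    unfolding power_mult using cocycle_commutator_pow [OF unitary_cocyclesD(1) [OF \<alpha>] g h, of n] hn
    by simp
  finally show ?thesis .
qed

text \<open>The trivial group has to be excluded: it contains \<open>C_1 \<times> C_1\<close>, while
  its cover has exponent 1. In general the exponent of the cover is a multiple of \<open>n\<close>
  and divides \<open>2 * n\<close>, so the question is whether \<open>n\<close> suffices.\<close>

theorem abelian_exponent_unitary_cover:
  assumes pG: "finite_p_group 2 G" and nontriv: "carrier G \<noteq> {\<one>}" and n: "group_exponent G = n"
  shows "group_exponent (unitary_cover G) =
    2 ^ (if \<exists>K. subgroup K G \<and> G\<lparr>carrier := K\<rparr> \<cong> integer_mod_group n \<times>\<times> integer_mod_group n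
      then 1 else 0) * group_exponent G"
proof -
  obtain k f where fin: "finite (carrier G)" and f: "n = 2 ^ f"
    using finite_p_group_exponent [OF two_is_prime_nat pG] n by metis
  have exp: "x [^] n = \<one>" if "x \<in> carrier G" for x
    using group_exponent_pow(2) [OF fin that] n by simp
  have "f \<noteq> 0"
  proof
    assume "f = 0"
    then have "x = \<one>" if "x \<in> carrier G" for x using exp [OF that] f that by simp
    then show False using nontriv by blast
  qed
  then obtain e where e: "n = 2 ^ Suc e"
    using f not0_implies_Suc by blast
  have low: "n dvd m"
    if "\<forall>x \<in> carrier (unitary_cover G). x [^]\<^bsub>unitary_cover G\<^esub> m = \<one>\<^bsub>unitary_cover G\<^esub>" for m :: nat
    using that group_exponent_dvd_iff [OF fin, of m] unfolding unitary_cover_pow_eq_one_iff n by simp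
  show ?thesis
  proof (cases "\<exists>K. subgroup K G \<and> G\<lparr>carrier := K\<rparr> \<cong> integer_mod_group n \<times>\<times> integer_mod_group n")
    case True
    then obtain \<alpha> g h where bad: "\<alpha> \<in> unitary_cocycles G" "g \<in> carrier G" "h \<in> carrier G" "\<alpha> (g, h) ^ n \<noteq> 1"
      using homocyclic_unitary_cocycle [OF fin e exp] by blast
    have "(\<forall>g \<in> carrier G. g [^] (2 * n) = \<one>) \<and>
      (\<forall>\<alpha> \<in> unitary_cocycles G. \<forall>g \<in> carrier G. \<forall>h \<in> carrier G. \<alpha> (g, h) ^ (2 * n) = 1)"
      using unitary_cocycle_pow_double exp group_exponent_dvd_iff [OF fin, of "2 * n"] n by simp
    then have "\<forall>x \<in> carrier (unitary_cover G).
        x [^]\<^bsub>unitary_cover G\<^esub> (2 * n) = \<one>\<^bsub>unitary_cover G\<^esub>"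
      unfolding unitary_cover_pow_eq_one_iff .
    moreover have "2 * n \<le> m" if "0 < m" and
      m: "\<forall>x \<in> carrier (unitary_cover G). x [^]\<^bsub>unitary_cover G\<^esub> m = \<one>\<^bsub>unitary_cover G\<^esub>" for m
    proof -
      obtain q where q: "m = n * q" using low [OF m] by blast
      have "m \<noteq> n"
        using m bad unfolding unitary_cover_pow_eq_one_iff by blast
      then have "q \<noteq> 0" "q \<noteq> 1" using q \<open>0 < m\<close> by auto
      then have "2 \<le> q" by simp
      then show ?thesis unfolding q by simp
    qed
    ultimately have "group_exponent (unitary_cover G) = 2 * n"
      using e by (intro group_exponent_eqI) auto
    then show ?thesis unfolding if_P [OF True] n by simp
  next
    case False
    have "(\<forall>g \<in> carrier G. g [^] n = \<one>) \<and>
      (\<forall>\<alpha> \<in> unitary_cocycles G. \<forall>g \<in> carrier G. \<forall>h \<in> carrier G. \<alpha> (g, h) ^ n = 1)"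
      using no_homocyclic_unitary_cocycle_pow [OF e exp False] exp by blast
    then have "\<forall>x \<in> carrier (unitary_cover G). x [^]\<^bsub>unitary_cover G\<^esub> n = \<one>\<^bsub>unitary_cover G\<^esub>"
      unfolding unitary_cover_pow_eq_one_iff .
    then have "group_exponent (unitary_cover G) = n"
      using e low by (intro group_exponent_eqI) (auto intro: dvd_imp_le)
    then show ?thesis unfolding if_not_P [OF False] n by simp
  qed
qed

end

theorem lemma3:
  fixes G :: "('a, 'b) monoid_scheme"
  shows
    "(\<forall>p :: nat. Factorial_Ring.prime p \<and> p > 2 \<and> finite_p_group p G \<and> powerful p G \<longrightarrow>
        group_exponent (unitary_cover G) = group_exponent G) \<and>
     (\<forall>n :: nat. comm_group G \<and> finite_p_group 2 G \<and> carrier G \<noteq> {\<one>\<^bsub>G\<^esub>} \<and>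
        group_exponent G = n \<longrightarrow>
        group_exponent (unitary_cover G) =
          2 ^ (if \<exists>K. subgroup K G \<and>
                    G\<lparr>carrier := K\<rparr> \<cong> integer_mod_group n \<times>\<times> integer_mod_group n
               then 1 else 0) * group_exponent G)"
proof (intro conjI allI impI)
  fix p :: nat
  assume "Factorial_Ring.prime p \<and> p > 2 \<and> finite_p_group p G \<and> powerful p G"
  then show "group_exponent (unitary_cover G) = group_exponent G"
    by (intro group.powerful_exponent_unitary_cover [of G p]) (auto simp: finite_p_group_def)
next
  fix n :: nat
  assume "comm_group G \<and> finite_p_group 2 G \<and> carrier G \<noteq> {\<one>\<^bsub>G\<^esub>} \<and> group_exponent G = n"
  then show "group_exponent (unitary_cover G) =
      2 ^ (if \<exists>K. subgroup K G \<and>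
                G\<lparr>carrier := K\<rparr> \<cong> integer_mod_group n \<times>\<times> integer_mod_group n
           then 1 else 0) * group_exponent G"
    using comm_group.abelian_exponent_unitary_cover [of G n] by blast
qed

end
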